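(* Set $\psi=\sinh^{-1} 1=\log(1+\sqrt{2})$. For all $n\in\mathbb{N}_0$, $\mathbf{s}=(s_1,\dots,s_d)\in\mathbb{N}^d$ and $y\in[-\psi,\psi]$ we have \begin{align*} \alpha(\mathbf{s};i\sinh y)_n=&\, (-1)^d \coth y \frac{d}{dy} \int_0^y \tilde p_{s_1}\circ\cdots\circ\tilde p_{s_d}\circ a_{n}(i\sinh t) \tanh t\,dt,\\ \sigma(\mathbf{s};i\sinh y)_n=&\,(-1)^d \frac{d}{dy}\int_0^y \tilde g_{s_1}\circ \cdots \circ \tilde g_{s_d}\circ b_n(i\sinh t) \,dt. \end{align*}
   Context: Iterated integrals are defined inductively (Chen): for $r>1$, $\int_a^b f_1(t)\,dt \cdots f_r(t)\,dt=\int_a^b f_1(\tau)\,d\tau \cdots f_{r-1}(\tau)\left(\int_a^\tau f_r(t)\,dt\right)d\tau$, and $\circ$ denotes concatenation of the 1-forms in such an iterated integral. The notation is extended to allow functions: for 1-forms $f_1(t)\,dt, f_2(t)\,dt$ and functions $F(t),G(t)$, $\big(F(t)+ f_1(t)\,dt\circ G(t)\big)\circ f_2(t)\,dt := F(t)f_2(t)\,dt+ f_1(t)\,dt \circ G(t)f_2(t)\,dt$ (a function followed by a 1-form means their product). Put $a_0(x)=1$, $a_n(x)=\binom{2n}{n}x^{2n}/4^n$, and $b_n(z)=\frac{4^n z^{2n}}{\binom{2n}{n}}$ for $n\ge0$. For $\mathbf{s}=(s_1,\dots,s_d)\in\mathbb{N}^d$, the $n$-tails are $\alpha(\mathbf{s};z)_n:=\sum_{n_1>\dots>n_d>n}\frac{a_{n_1}(z)}{(2n_1)^{s_1}\cdots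 (2n_d)^{s_d}}$ and $\sigma(\mathbf{s};z)_n:=\sum_{n_1>\dots>n_d>n}\frac{b_{n_1}(z)}{(2n_1)^{s_1}\cdots (2n_d)^{s_d}}$. Hyperbolic functions: $\sinh z=(e^z-e^{-z})/2$, $\cosh z=(e^z+e^{-z})/2$, $\tanh z=\sinh z/\cosh z$, $\coth z=\cosh z/\sinh z$, $\operatorname{csch} z=1/\sinh z$, $\operatorname{sech} z=1/\cosh z$. Define \[ \tilde p_s(t)= \tanh t\,dt\, (\coth t\,dt)^{s-1} ( 1-\operatorname{csch} t \,dt\circ\operatorname{sech} t), \qquad \tilde g_s(t)=\begin{cases} \tanh t\, dt, & s=1;\\ dt \circ (\coth t\, dt)^{s-2}\circ dt, & s\ge 2.\end{cases} \] *)

theory Defs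
  imports "HOL-Analysis.Analysis"
begin

section \<open>Hyperbolic functions\<close>

definition coth :: "real \<Rightarrow> real" where "coth t = cosh t / sinh t"
definition csch :: "real \<Rightarrow> real" where "csch t = 1 / sinh t"
definition sech :: "real \<Rightarrow> real" where "sech t = 1 / cosh t"

definition psi :: real where "psi = arsinh 1"

lemma psi_eq_ln: "psi = ln (1 + sqrt 2)"
  by (simp add: psi_def arsinh_real_def)

section \<open>Tails of the multiple series\<close>

definition a_coeff :: "nat \<Rightarrow> complex \<Rightarrow> complex" where
  "a_coeff n z = of_nat ((2 * n) choose n) * z ^ (2 * n) / 4 ^ n"

definition b_coeff :: "nat \<Rightarrow> complex \<Rightarrow> complex" where
  "b_coeff n z = 4 ^ n * z ^ (2 * n) / of_nat ((2 * n) choose n)"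

definition index_tuples :: "nat \<Rightarrow> nat \<Rightarrow> nat \<Rightarrow> nat list set" where
  "index_tuples d n N = {ns. length ns = d \<and> sorted_wrt (>) ns \<and> set ns \<subseteq> {n<..N}}"

text \<open>
  The sum over \<open>N \<ge> n\<^sub>1 > \<dots> > n\<^sub>d > n\<close>. The series over all \<open>n\<^sub>1 > \<dots> > n\<^sub>d > n\<close> is the limit for
  \<open>N \<longlonglongrightarrow> \<infinity>\<close>; it need not converge absolutely at \<open>y = \<plusminus>psi\<close> (take \<open>b_coeff\<close> and \<open>s\<^sub>1 = 1\<close>),
  so an unordered sum would not do.
\<close>

definition truncated_tail :: "(nat \<Rightarrow> complex) \<Rightarrow> nat list \<Rightarrow> nat \<Rightarrow> nat \<Rightarrow> complex" where
  "truncated_tail c s n N =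
     (\<Sum>ns \<in> index_tuples (length s) n N.
        c (hd ns) / (\<Prod>j<length s. (2 * of_nat (ns ! j)) ^ (s ! j)))"

definition alpha_trunc :: "nat list \<Rightarrow> complex \<Rightarrow> nat \<Rightarrow> nat \<Rightarrow> complex" where
  "alpha_trunc s z n = truncated_tail (\<lambda>m. a_coeff m z) s n"

definition sigma_trunc :: "nat list \<Rightarrow> complex \<Rightarrow> nat \<Rightarrow> nat \<Rightarrow> complex" where
  "sigma_trunc s z n = truncated_tail (\<lambda>m. b_coeff m z) s n"

definition alpha_tail :: "nat list \<Rightarrow> complex \<Rightarrow> nat \<Rightarrow> complex" where
  "alpha_tail s z n = lim (alpha_trunc s z n)"

definition sigma_tail :: "nat list \<Rightarrow> complex \<Rightarrow> nat \<Rightarrow> complex" where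
  "sigma_tail s z n = lim (sigma_trunc s z n)"

section \<open>Iterated integrals\<close>

text \<open>
  The list \<open>[f\<^sub>1, \<dots>, f\<^sub>r]\<close> stands for \<open>f\<^sub>1(t) dt \<dots> f\<^sub>r(t) dt\<close>; the first form is the outermost one.
  The integral is oriented, so \<open>b < a\<close> is allowed.
\<close>

primrec iterated_integral :: "(real \<Rightarrow> complex) list \<Rightarrow> real \<Rightarrow> real \<Rightarrow> complex" where
  "iterated_integral [] a b = 1"
| "iterated_integral (f # fs) a b = (LBINT t=ereal a..ereal b. f t * iterated_integral fs a t)"

text \<open>
  Formal expressions in 1-forms and functions. A triple \<open>(c, [f\<^sub>1, \<dots>, f\<^sub>k], G)\<close> stands for
  \<open>c f\<^sub>1(t) dt \<circ> \<dots> \<circ> f\<^sub>k(t) dt \<circ> G(t)\<close>, and a list of triples for their sum. A 1-form has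
  trailing function 1; a function has an empty list of forms.
\<close>

type_synonym form_expr = "(complex \<times> (real \<Rightarrow> complex) list \<times> (real \<Rightarrow> complex)) list"

definition form :: "(real \<Rightarrow> real) \<Rightarrow> form_expr" where
  "form f = [(1, [\<lambda>t. of_real (f t)], \<lambda>t. 1)]"

definition func :: "(real \<Rightarrow> real) \<Rightarrow> form_expr" where
  "func G = [(1, [], \<lambda>t. of_real (G t))]"

definition expr_one :: form_expr where
  "expr_one = func (\<lambda>t. 1)"

definition expr_diff :: "form_expr \<Rightarrow> form_expr \<Rightarrow> form_expr" where
  "expr_diff A B = A @ map (\<lambda>(c, w, G). (- c, w, G)) B"

text \<open>A function followed by a 1-form (or by a function) is multiplied into it.\<close>

fun absorb :: "(real \<Rightarrow> complex) \<Rightarrow> (real \<Rightarrow> complex) list \<times> (real \<Rightarrow> complex)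
    \<Rightarrow> (real \<Rightarrow> complex) list \<times> (real \<Rightarrow> complex)" where
  "absorb G ([], H) = ([], \<lambda>t. G t * H t)"
| "absorb G (f # w, H) = ((\<lambda>t. G t * f t) # w, H)"

definition expr_comp :: "form_expr \<Rightarrow> form_expr \<Rightarrow> form_expr"  (infixr "\<odot>" 70) where
  "A \<odot> B = concat (map (\<lambda>(c, w, G). map (\<lambda>(c', vH).
      (c * c', w @ fst (absorb G vH), snd (absorb G vH))) B) A)"

fun expr_power :: "form_expr \<Rightarrow> nat \<Rightarrow> form_expr" where
  "expr_power A 0 = expr_one"
| "expr_power A (Suc k) = A \<odot> expr_power A k"

definition expr_prod :: "form_expr list \<Rightarrow> form_expr" where
  "expr_prod As = foldr (\<odot>) As expr_one"

text \<open>
  The integral from \<open>a\<close> to \<open>b\<close> of \<open>A \<circ> f(t) dt\<close>. It is linear in \<open>A\<close>, and the trailing function of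
  each summand of \<open>A\<close> is multiplied into the final 1-form.
\<close>

definition expr_integral :: "real \<Rightarrow> real \<Rightarrow> form_expr \<Rightarrow> (real \<Rightarrow> complex) \<Rightarrow> complex" where
  "expr_integral a b A f =
     (\<Sum>(c, w, G) \<leftarrow> A. c * iterated_integral (w @ [\<lambda>t. G t * f t]) a b)"

definition p_tilde :: "nat \<Rightarrow> form_expr" where
  "p_tilde s = form tanh \<odot> expr_power (form coth) (s - 1) \<odot>
     expr_diff expr_one (form csch \<odot> func sech)"

definition g_tilde :: "nat \<Rightarrow> form_expr" where
  "g_tilde s = (if s = 1 then form tanh
     else form (\<lambda>t. 1) \<odot> expr_power (form coth) (s - 2) \<odot> form (\<lambda>t. 1))"

definition alpha_integral :: "nat list \<Rightarrow> nat \<Rightarrow> real \<Rightarrow> complex" where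
  "alpha_integral s n y =
     expr_integral 0 y (expr_prod (map p_tilde s))
       (\<lambda>t. a_coeff n (\<i> * of_real (sinh t)) * of_real (tanh t))"

definition sigma_integral :: "nat list \<Rightarrow> nat \<Rightarrow> real \<Rightarrow> complex" where
  "sigma_integral s n y =
     expr_integral 0 y (expr_prod (map g_tilde s))
       (\<lambda>t. b_coeff n (\<i> * of_real (sinh t)))"

end

theory Submission
  imports Defs "HOL-Real_Asymp.Real_Asymp"
begin

text \<open>
  Write \<open>P\<^sub>k\<close> for the operator on functions such that appending a factor with index \<open>k\<close> to the iterated
  integral replaces its last function \<open>h\<close> by \<open>P\<^sub>k h\<close>. The whole theorem rests on one telescoping
  identity: with \<open>f\<^sub>m(t) = a\<^sub>m(\<i> sinh t) tanh t\<close>, respectively \<open>f\<^sub>m(t) = b\<^sub>m(\<i> sinh t)\<close>, one has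
  \<open>P\<^sub>k f\<^sub>m - P\<^sub>k f\<^bsub>m-1\<^esub> = f\<^sub>m / (2m)\<^sup>k\<close>. Hence the sum over \<open>N \<ge> n\<^sub>1 > \<dots> > n\<^sub>d > n\<close> equals
  \<open>(-1)\<^sup>d P\<^bsub>s\<^sub>1\<^esub> \<dots> P\<^bsub>s\<^sub>d\<^esub> f\<^sub>n\<close> up to terms containing \<open>f\<^sub>N\<close>. On \<open>[-psi, psi]\<close> those are
  \<open>O(N\<^bsup>-1/2\<^esup> (log N)\<^sup>d)\<close>, endpoints included, so that no separate argument of Abel type is needed.
\<close>

section \<open>Truncated tails and telescoping operators\<close>

text \<open>The difficulty sits at both ends of the range. At \<open>t = 0\<close> the weights
  \<open>coth\<close> and \<open>csch\<close> have poles, so sup norms do not pass through the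
  operators. What does pass is a bound \<open>norm (h t) \<le> M * \<bar>t\<bar>\<close>:
  integration improves it to \<open>M * t^2\<close>, and a simple pole takes one factor back. The
  \<alpha> integrands vanish at \<open>0\<close> because of \<open>tanh\<close>, so the bound
  applies to them directly. The \<sigma> integrands resist twice: \<open>b_form 0\<close> is
  \<open>1\<close> even at \<open>0\<close>, and at \<open>\<bar>t\<bar> = psi\<close> the functions
  \<open>b_form N\<close> grow like \<open>sqrt N\<close>. One integration cures both. The innermost
  form of every \<open>g_tilde\<close> is \<open>tanh t dt\<close> or \<open>dt\<close>, free of
  poles, and integrating \<open>sinh ^ (2 * N)\<close> gains a factor of order \<open>1 / N\<close>.
  The two series therefore live on different function spaces and share only an abstract summation
  argument, in which every summation costs at most one harmonic sum.\<close>

lemma truncated_tail_snoc: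
  fixes c :: "nat \<Rightarrow> complex"
  shows "truncated_tail c (s @ [k]) n N =
    (\<Sum>m\<in>{n<..N}. (if s = [] then c m else truncated_tail c s m N) / (2 * of_nat m) ^ k)"
proof -
  let ?g = "\<lambda>s ns. c (hd ns) / (\<Prod>j<length s. (2 * of_nat (ns ! j)) ^ (s ! j))"
  let ?S = "SIGMA m:{n<..N}. index_tuples (length s) m N"
  have fin: "finite (index_tuples d m N)" for d m
    by (rule finite_subset[OF _ finite_lists_length_eq[of "{m<..N}" d]]) (auto simp: index_tuples_def)
  have "truncated_tail c (s @ [k]) n N = (\<Sum>(m, ns)\<in>?S. ?g (s @ [k]) (ns @ [m]))"
    unfolding truncated_tail_def
  proof (rule sum.reindex_bij_witness[of _ "\<lambda>(m, ns). ns @ [m]" "\<lambda>ns. (last ns, butlast ns)"])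
    fix ns assume ns: "ns \<in> index_tuples (length (s @ [k])) n N"
    then obtain xs m where "ns = xs @ [m]"
      by (cases ns rule: rev_cases) (auto simp: index_tuples_def)
    with ns show "(case (last ns, butlast ns) of (m, ns) \<Rightarrow> ns @ [m]) = ns"
      "(last ns, butlast ns) \<in> ?S"
      "(case (last ns, butlast ns) of (m, ns) \<Rightarrow> ?g (s @ [k]) (ns @ [m])) = ?g (s @ [k]) ns"
      by (auto simp: index_tuples_def sorted_wrt_append)
  qed (force simp: index_tuples_def sorted_wrt_append)+
  also have "\<dots> = (\<Sum>m\<in>{n<..N}. \<Sum>ns\<in>index_tuples (length s) m N. ?g (s @ [k]) (ns @ [m]))"
    by (subst sum.Sigma) (auto simp: fin)
  also have "\<dots> = (\<Sum>m\<in>{n<..N}. (if s = [] then c m else truncated_tail c s m N) / (2 * of_nat m) ^ k)"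
  proof (rule sum.cong[OF refl])
    fix m assume "m \<in> {n<..N}"
    show "(\<Sum>ns\<in>index_tuples (length s) m N. ?g (s @ [k]) (ns @ [m])) =
      (if s = [] then c m else truncated_tail c s m N) / (2 * of_nat m) ^ k"
    \<comment> \<open>The coefficient is read at the first entry of the tuple. For
      \<open>s = []\<close> the appended index is itself that first entry, hence the separate
      case.\<close>
    proof (cases "s = []")
      case True
      have "index_tuples 0 m N = {[]}" by (auto simp: index_tuples_def)
      with True show ?thesis by simp
    next
      case False
      have "?g (s @ [k]) (ns @ [m]) = ?g s ns / (2 * of_nat m) ^ k"
        if "ns \<in> index_tuples (length s) m N" for ns
      proof -
        have len: "length ns = length s" using that by (simp add: index_tuples_def)
        have "(\<Prod>j<length s. (2 * of_nat ((ns @ [m]) ! j)) ^ ((s @ [k]) ! j)) =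
           (\<Prod>j<length s. (2 * of_nat (ns ! j)) ^ (s ! j) :: complex)"
          by (rule prod.cong) (auto simp: nth_append len)
        moreover have "ns \<noteq> []" using len False by auto
        ultimately show ?thesis by (simp add: nth_append len)
      qed
      then show ?thesis using False by (simp add: truncated_tail_def sum_divide_distrib)
    qed
  qed
  finally show ?thesis .
qed

text \<open>\<open>V\<close> is a parameter because the two series need different domains. Linearity
  on \<open>V\<close> is what carries an identity between innermost functions outward through
  \<open>foldr P s\<close>.\<close>

locale telescoping_operators =
  fixes V :: "(real \<Rightarrow> complex) set"
    and P :: "nat \<Rightarrow> (real \<Rightarrow> complex) \<Rightarrow> real \<Rightarrow> complex"
    and f :: "nat \<Rightarrow> real \<Rightarrow> complex"
  assumes P_V: "\<And>k u. 1 \<le> k \<Longrightarrow> u \<in> V \<Longrightarrow> P k u \<in> V"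
    and P_combine: "\<And>k u v a b. 1 \<le> k \<Longrightarrow> u \<in> V \<Longrightarrow> v \<in> V \<Longrightarrow>
      P k (\<lambda>t. a * u t + b * v t) = (\<lambda>t. a * P k u t + b * P k v t)"
    and f_V: "\<And>m. f m \<in> V"
    and step: "\<And>k m t. 1 \<le> k \<Longrightarrow>
      P k (f (Suc m)) t - P k (f m) t = f (Suc m) t / (2 * of_nat (Suc m)) ^ k"
begin

lemma foldr_V: "\<forall>k\<in>set s. 1 \<le> k \<Longrightarrow> u \<in> V \<Longrightarrow> foldr P s u \<in> V"
  by (induction s) (simp_all add: P_V del: One_nat_def)

lemma foldr_combine:
  assumes "\<forall>k\<in>set s. 1 \<le> k" "u \<in> V" "v \<in> V"
  shows "foldr P s (\<lambda>t. a * u t + b * v t) = (\<lambda>t. a * foldr P s u t + b * foldr P s v t)"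
  using assms by (induction s) (simp_all add: P_combine foldr_V del: One_nat_def)

text \<open>Peel off the smallest index \<open>m\<close>. The inner sum is its limit value plus an
  error controlled uniformly in \<open>m \<le> N\<close>; the limit values telescope to a boundary
  term at \<open>N\<close> and the claimed value at \<open>n\<close>. This is why the bound must
  hold for all \<open>n\<close> at once with a right side depending on \<open>N\<close> only. The
  hypothesis \<open>bound\<close> leaves out the empty list since \<open>f N y\<close> itself may
  grow, as \<open>b_form N\<close> does at the endpoints.\<close>

lemma truncated_tail_error:
  assumes bound: "\<And>s. s \<noteq> [] \<Longrightarrow> \<forall>k\<in>set s. 1 \<le> k \<Longrightarrow> \<exists>C. \<forall>N. norm (foldr P s (f N) y) \<le> C * \<epsilon> N"
    and \<epsilon>: "\<And>N. 0 \<le> \<epsilon> N"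
    and s: "\<forall>k\<in>set s. 1 \<le> k"
  shows "\<exists>C\<ge>0. \<forall>n N. n \<le> N \<longrightarrow>
    norm ((if s = [] then f n y else truncated_tail (\<lambda>m. f m y) s n N)
       - (- 1) ^ length s * foldr P s (f n) y)
      \<le> C * \<epsilon> N * (1 + (\<Sum>m=1..N. 1 / (2 * real m))) ^ length s"
  using s
proof (induction s rule: rev_induct)
  case Nil
  show ?case by (intro exI[of _ 0]) simp
next
  case (snoc k s)
  \<comment> \<open>The summand \<open>1\<close> makes every power of \<open>?H N\<close> at least
    \<open>1\<close>, so the boundary term at \<open>N\<close> fits under the same bound.\<close>
  let ?H = "\<lambda>N. 1 + (\<Sum>m=1..N. 1 / (2 * real m))"
  let ?T = "\<lambda>s n N. if s = [] then f n y else truncated_tail (\<lambda>m. f m y) s n N"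
  have k: "1 \<le> k" and s: "\<forall>k\<in>set s. 1 \<le> k" using snoc.prems by auto
  obtain C where C: "C \<ge> 0" and IH: "\<And>n N. n \<le> N \<Longrightarrow>
    norm (?T s n N - (- 1) ^ length s * foldr P s (f n) y) \<le> C * \<epsilon> N * ?H N ^ length s"
    using snoc.IH[OF s] by blast
  obtain B where B: "\<And>N. norm (foldr P (s @ [k]) (f N) y) \<le> B * \<epsilon> N"
    using bound[OF _ snoc.prems] by blast
  have telescope: "(\<Sum>m\<in>{n<..N}. foldr P s (f m) y / (2 * of_nat m) ^ k)
      = foldr P s (P k (f N)) y - foldr P s (P k (f n)) y" if "n \<le> N" for n N
    using that
  proof (induction N rule: nat_induct_at_least)
    case base
    show ?case by simp
  next
    case (Suc N)
    let ?q = "(2 * of_nat (Suc N)) ^ k :: complex"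
    \<comment> \<open>\<open>step\<close> is read as an equation of functions, so that
      \<open>foldr P s\<close> can be applied to both sides. The zero summand only brings a scalar
      multiple into the shape of \<open>foldr_combine\<close>.\<close>
    have "(\<lambda>t. (1 / ?q) * f (Suc N) t + 0 * f (Suc N) t) = (\<lambda>t. 1 * P k (f (Suc N)) t + (- 1) * P k (f N) t)"
      using step[OF k, of N] by (intro ext) (simp del: of_nat_Suc)
    then have "foldr P s (\<lambda>t. (1 / ?q) * f (Suc N) t + 0 * f (Suc N) t) y =
        foldr P s (\<lambda>t. 1 * P k (f (Suc N)) t + (- 1) * P k (f N) t) y"
      by (rule arg_cong)
    also have "\<dots> = 1 * foldr P s (P k (f (Suc N))) y + (- 1) * foldr P s (P k (f N)) y"
      by (simp only: foldr_combine[OF s P_V[OF k f_V[of "Suc N"]] P_V[OF k f_V[of N]]])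
    finally have "(1 / ?q) * foldr P s (f (Suc N)) y + 0 * foldr P s (f (Suc N)) y =
        1 * foldr P s (P k (f (Suc N))) y + (- 1) * foldr P s (P k (f N)) y"
      by (simp only: foldr_combine[OF s f_V[of "Suc N"] f_V[of "Suc N"]])
    then have "foldr P s (f (Suc N)) y / ?q = foldr P s (P k (f (Suc N))) y - foldr P s (P k (f N)) y"
      by (simp del: of_nat_Suc)
    moreover have "{n<..Suc N} = insert (Suc N) {n<..N}" using Suc.hyps by auto
    ultimately show ?case using Suc.IH by (simp del: of_nat_Suc)
  qed
  show ?case
  proof (intro exI[of _ "\<bar>B\<bar> + C"] conjI allI impI)
    show "0 \<le> \<bar>B\<bar> + C" using C by simp
    fix n N :: nat assume nN: "n \<le> N"
    let ?e = "\<lambda>m. ?T s m N - (- 1) ^ length s * foldr P s (f m) y"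
    have H: "?H N \<ge> 1" by (simp add: sum_nonneg)
    have "truncated_tail (\<lambda>m. f m y) (s @ [k]) n N = (\<Sum>m\<in>{n<..N}. ?T s m N / (2 * of_nat m) ^ k)"
      by (rule truncated_tail_snoc)
    also have "\<dots> = (\<Sum>m\<in>{n<..N}. ?e m / (2 * of_nat m) ^ k
        + (- 1) ^ length s * (foldr P s (f m) y / (2 * of_nat m) ^ k))"
      by (rule sum.cong[OF refl]) (simp add: diff_divide_distrib)
    also have "\<dots> = (\<Sum>m\<in>{n<..N}. ?e m / (2 * of_nat m) ^ k) +
        (- 1) ^ length s * (foldr P s (P k (f N)) y - foldr P s (P k (f n)) y)"
      by (simp only: sum.distrib telescope[OF nN] flip: sum_distrib_left)
    finally have eq: "?T (s @ [k]) n N - (- 1) ^ length (s @ [k]) * foldr P (s @ [k]) (f n) y =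
        (\<Sum>m\<in>{n<..N}. ?e m / (2 * of_nat m) ^ k) + (- 1) ^ length s * foldr P (s @ [k]) (f N) y"
      by (simp add: right_diff_distrib)
    have "norm (\<Sum>m\<in>{n<..N}. ?e m / (2 * of_nat m) ^ k)
        \<le> (\<Sum>m\<in>{n<..N}. C * \<epsilon> N * ?H N ^ length s * (1 / (2 * real m)))"
    proof (rule sum_norm_le)
      fix m assume m: "m \<in> {n<..N}"
      have "2 * real m \<le> (2 * real m) ^ k"
        using m k by (intro self_le_power) auto
      then have "1 / (2 * real m) ^ k \<le> 1 / (2 * real m)"
        using m by (intro divide_left_mono) auto
      then have "norm (?e m) * (1 / (2 * real m) ^ k) \<le> (C * \<epsilon> N * ?H N ^ length s) * (1 / (2 * real m))"
        using IH[of m N] m C \<epsilon>[of N] H by (intro mult_mono) auto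
      then show "norm (?e m / (2 * of_nat m) ^ k) \<le> C * \<epsilon> N * ?H N ^ length s * (1 / (2 * real m))"
        by (simp add: norm_divide norm_power norm_mult)
    qed
    also have "\<dots> = C * \<epsilon> N * ?H N ^ length s * (\<Sum>m\<in>{n<..N}. 1 / (2 * real m))"
      by (simp only: sum_distrib_left)
    also have "\<dots> \<le> C * \<epsilon> N * ?H N ^ length s * ?H N"
    proof (rule mult_left_mono)
      have "(\<Sum>m\<in>{n<..N}. 1 / (2 * real m)) \<le> (\<Sum>m=1..N. 1 / (2 * real m))"
        by (rule sum_mono2) auto
      then show "(\<Sum>m\<in>{n<..N}. 1 / (2 * real m)) \<le> ?H N" by simp
    qed (use C \<epsilon>[of N] H in auto)
    finally have 1: "norm (\<Sum>m\<in>{n<..N}. ?e m / (2 * of_nat m) ^ k) \<le> C * \<epsilon> N * ?H N ^ length (s @ [k])"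
      by (simp only: length_append_singleton power_Suc2 mult.assoc)
    have "norm ((- 1) ^ length s * foldr P (s @ [k]) (f N) y) \<le> B * \<epsilon> N"
      using B[of N] by (simp add: norm_mult norm_power)
    also have "\<dots> \<le> \<bar>B\<bar> * \<epsilon> N * ?H N ^ length (s @ [k])"
    proof -
      have "B * \<epsilon> N \<le> \<bar>B\<bar> * \<epsilon> N * 1" using \<epsilon>[of N] by (simp add: mult_right_mono)
      also have "\<dots> \<le> \<bar>B\<bar> * \<epsilon> N * ?H N ^ length (s @ [k])"
        using \<epsilon>[of N] H by (intro mult_left_mono one_le_power) auto
      finally show ?thesis .
    qed
    finally have 2: "norm ((- 1) ^ length s * foldr P (s @ [k]) (f N) y) \<le> \<bar>B\<bar> * \<epsilon> N * ?H N ^ length (s @ [k])" .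
    have expand: "(\<bar>B\<bar> + C) * u * v = C * u * v + \<bar>B\<bar> * u * v" for u v
      by (simp add: algebra_simps)
    have "norm (?T (s @ [k]) n N - (- 1) ^ length (s @ [k]) * foldr P (s @ [k]) (f n) y)
      = norm ((\<Sum>m\<in>{n<..N}. ?e m / (2 * of_nat m) ^ k) + (- 1) ^ length s * foldr P (s @ [k]) (f N) y)"
      by (rule arg_cong[OF eq])
    also have "\<dots> \<le> norm (\<Sum>m\<in>{n<..N}. ?e m / (2 * of_nat m) ^ k)
        + norm ((- 1) ^ length s * foldr P (s @ [k]) (f N) y)"
      by (rule norm_triangle_ineq)
    also have "\<dots> \<le> C * \<epsilon> N * ?H N ^ length (s @ [k]) + \<bar>B\<bar> * \<epsilon> N * ?H N ^ length (s @ [k])"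
      by (rule add_mono[OF 1 2])
    also have "\<dots> = (\<bar>B\<bar> + C) * \<epsilon> N * ?H N ^ length (s @ [k])"
      by (rule expand[symmetric])
    finally show "norm (?T (s @ [k]) n N - (- 1) ^ length (s @ [k]) * foldr P (s @ [k]) (f n) y)
      \<le> (\<bar>B\<bar> + C) * \<epsilon> N * ?H N ^ length (s @ [k])" .
  qed
qed

lemma truncated_tail_tendsto:
  assumes bound: "\<And>s. s \<noteq> [] \<Longrightarrow> \<forall>k\<in>set s. 1 \<le> k \<Longrightarrow> \<exists>C. \<forall>N. norm (foldr P s (f N) y) \<le> C * \<epsilon> N"
    and \<epsilon>: "\<And>N. 0 \<le> \<epsilon> N"
    and lim: "\<And>d. (\<lambda>N. \<epsilon> N * (1 + (\<Sum>m=1..N. 1 / (2 * real m))) ^ d) \<longlonglongrightarrow> 0"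
    and s: "s \<noteq> []" "\<forall>k\<in>set s. 1 \<le> k"
  shows "(\<lambda>N. truncated_tail (\<lambda>m. f m y) s n N) \<longlonglongrightarrow> (- 1) ^ length s * foldr P s (f n) y"
proof -
  let ?H = "\<lambda>N. 1 + (\<Sum>m=1..N. 1 / (2 * real m))"
  have "\<exists>C\<ge>0. \<forall>n N. n \<le> N \<longrightarrow>
    norm ((if s = [] then f n y else truncated_tail (\<lambda>m. f m y) s n N)
       - (- 1) ^ length s * foldr P s (f n) y) \<le> C * \<epsilon> N * ?H N ^ length s"
    by (rule truncated_tail_error) (fact bound \<epsilon> s(2))+
  then obtain C where C: "\<forall>n N. n \<le> N \<longrightarrow>
    norm ((if s = [] then f n y else truncated_tail (\<lambda>m. f m y) s n N)
      - (- 1) ^ length s * foldr P s (f n) y) \<le> C * \<epsilon> N * ?H N ^ length s"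
    by (elim exE conjE)
  have "(\<lambda>N. C * (\<epsilon> N * ?H N ^ length s)) \<longlonglongrightarrow> C * 0" by (intro tendsto_mult_left lim)
  then have "(\<lambda>N. C * \<epsilon> N * ?H N ^ length s) \<longlonglongrightarrow> 0" by (simp add: mult.assoc)
  moreover have "\<forall>\<^sub>F N in sequentially.
      norm (truncated_tail (\<lambda>m. f m y) s n N - (- 1) ^ length s * foldr P s (f n) y)
      \<le> C * \<epsilon> N * ?H N ^ length s"
    using C[rule_format, of n] s(1) by (intro eventually_sequentiallyI[of n]) (simp only: if_False)
  ultimately have "(\<lambda>N. truncated_tail (\<lambda>m. f m y) s n N - (- 1) ^ length s * foldr P s (f n) y) \<longlonglongrightarrow> 0"
    by (rule Lim_null_comparison[rotated])
  then show ?thesis by (rule LIM_zero_cancel)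
qed

end

section \<open>Primitives and iterated integrals\<close>

definition prim :: "(real \<Rightarrow> complex) \<Rightarrow> real \<Rightarrow> complex" where
  "prim f t = (LBINT u=ereal 0..ereal t. f u)"

lemma prim_0 [simp]: "prim f 0 = 0"
  by (simp add: prim_def)

lemma prim_divide: "prim (\<lambda>u. f u / c) t = prim f t / c"
  by (simp add: prim_def)

lemma prim_has_vector_derivative:
  assumes "continuous_on UNIV f"
  shows "(prim f has_vector_derivative f t) (at t)"
proof -
  let ?r = "\<bar>t\<bar> + 1"
  have "((\<lambda>u. LBINT y=ereal 0..ereal u. f y) has_vector_derivative f t) (at t within {-?r..?r})"
    by (rule interval_integral_FTC2) (auto intro: continuous_on_subset[OF assms])
  moreover have "at t within {-?r..?r} = at t"
    by (rule at_within_interior) (auto simp: interior_atLeastAtMost_real abs_if)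
  ultimately show ?thesis by (simp add: prim_def[abs_def])
qed

lemma continuous_on_prim: "continuous_on UNIV f \<Longrightarrow> continuous_on UNIV (prim f)"
  by (meson UNIV_I continuous_at_imp_continuous_on has_vector_derivative_continuous prim_has_vector_derivative)

lemma prim_eqI:
  assumes "continuous_on UNIV f" "\<And>t. (F has_vector_derivative f t) (at t)"
  shows "prim f t = F t - F 0"
  unfolding prim_def using assms
  by (intro interval_integral_FTC_finite)
    (auto intro: continuous_on_subset has_vector_derivative_at_within)

lemma prim_combine:
  assumes "continuous_on UNIV f" "continuous_on UNIV g"
  shows "prim (\<lambda>u. a * f u + b * g u) t = a * prim f t + b * prim g t"
  using assms
  by (subst prim_eqI[where F = "\<lambda>t. a * prim f t + b * prim g t"])
    (auto intro!: continuous_intros derivative_eq_intros prim_has_vector_derivative)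

text \<open>One factor \<open>\<bar>t\<bar>\<close> comes from the bound on \<open>h\<close>, the
  other from the length of the interval. The second is the one a simple pole will consume.\<close>

lemma norm_prim_le:
  assumes h: "continuous_on UNIV h" and M: "\<And>t. \<bar>t\<bar> \<le> r \<Longrightarrow> norm (h t) \<le> M * \<bar>t\<bar>"
    and "0 \<le> M" and t: "\<bar>t\<bar> \<le> r"
  shows "norm (prim h t) \<le> M * \<bar>t\<bar> * \<bar>t\<bar>"
proof -
  have h0: "h 0 = 0" using M[of 0] t by simp
  have "norm (prim h t - prim h 0 - (t - 0) *\<^sub>R h 0) \<le> norm (t - 0) * (M * \<bar>t\<bar>)"
  proof (rule vector_differentiable_bound_linearization[where S = "closed_segment 0 t"])
    fix x assume x: "x \<in> closed_segment 0 t"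
    show "(prim h has_vector_derivative h x) (at x within closed_segment 0 t)"
      using prim_has_vector_derivative[OF h] has_vector_derivative_at_within by blast
    have "\<bar>x\<bar> \<le> \<bar>t\<bar>" using x by (auto simp: closed_segment_eq_real_ivl split: if_splits)
    then have "norm (h x) \<le> M * \<bar>x\<bar>" "M * \<bar>x\<bar> \<le> M * \<bar>t\<bar>"
      using M[of x] t \<open>0 \<le> M\<close> by (auto intro: mult_left_mono)
    then show "norm (h x - h 0) \<le> M * \<bar>t\<bar>" by (simp add: h0)
  qed auto
  then show ?thesis by (simp add: h0 ac_simps)
qed

section \<open>Simple poles at 0 against functions vanishing there\<close>

definition cont0 :: "(real \<Rightarrow> complex) set" where
  "cont0 = {h. continuous_on UNIV h \<and> h 0 = 0}"

text \<open>The estimate is asked for only up to \<open>psi\<close>, the range of the series, but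
  continuity on both half-lines, so that primitives are differentiable from both sides at
  \<open>psi\<close> and \<open>- psi\<close> too.\<close>

definition weight :: "(real \<Rightarrow> complex) \<Rightarrow> bool" where
  "weight g \<longleftrightarrow> (\<forall>t. t \<noteq> 0 \<longrightarrow> isCont g t) \<and> (\<exists>K. \<forall>t. \<bar>t\<bar> \<le> psi \<longrightarrow> norm (of_real t * g t) \<le> K)"

lemma psi_pos: "0 < psi"
  by (simp add: psi_def)

lemma cont0_combine: "u \<in> cont0 \<Longrightarrow> v \<in> cont0 \<Longrightarrow> (\<lambda>t. a * u t + b * v t) \<in> cont0"
  by (auto simp: cont0_def intro!: continuous_intros)

lemma prim_cont0: "continuous_on UNIV h \<Longrightarrow> prim h \<in> cont0"
  by (simp add: cont0_def continuous_on_prim)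

lemma mult_cont0: "continuous_on UNIV G \<Longrightarrow> h \<in> cont0 \<Longrightarrow> (\<lambda>t. G t * h t) \<in> cont0"
  by (auto simp: cont0_def intro!: continuous_intros)

text \<open>A weight may have a simple pole at \<open>0\<close>, where \<open>coth\<close> and \<open>csch\<close> take the junk value \<open>0\<close>. Since
  \<open>prim h\<close> is \<open>o(t)\<close> if \<open>h 0 = 0\<close>, this is also the limit of \<open>g t * prim h t\<close>.\<close>

lemma weight_prim_cont0:
  assumes g: "weight g" and h: "h \<in> cont0"
  shows "(\<lambda>t. g t * prim h t) \<in> cont0"
proof -
  have h': "continuous_on UNIV h" "h 0 = 0" using h by (auto simp: cont0_def)
  obtain K where K: "\<And>t. \<bar>t\<bar> \<le> psi \<Longrightarrow> norm (of_real t * g t) \<le> K"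
    using g by (auto simp: weight_def)
  have prim_cont: "isCont (prim h) t" for t
    using prim_has_vector_derivative[OF h'(1)] has_vector_derivative_continuous by blast
  have "((\<lambda>t. prim h t /\<^sub>R t) \<longlongrightarrow> 0) (at 0)"
  proof -
    have "((\<lambda>t. (prim h t - prim h 0 - (t - 0) *\<^sub>R h 0) /\<^sub>R norm (t - 0)) \<longlongrightarrow> 0) (at 0)"
      using prim_has_vector_derivative[OF h'(1), of 0]
      unfolding has_vector_derivative_def has_derivative_def
      by (simp add: h'(2))
    then show ?thesis
      by (subst tendsto_norm_zero_iff[symmetric], subst (asm) tendsto_norm_zero_iff[symmetric])
        (simp add: h'(2))
  qed
  then have lim: "((\<lambda>t. K * norm (prim h t /\<^sub>R t)) \<longlongrightarrow> 0) (at 0)"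
    by (intro tendsto_mult_right_zero tendsto_norm_zero)
  have "isCont (\<lambda>t. g t * prim h t) 0"
  proof -
    have "((\<lambda>t. g t * prim h t) \<longlongrightarrow> 0) (at 0)"
    proof (rule Lim_null_comparison[OF _ lim])
      have "\<forall>\<^sub>F t in at (0::real). t \<in> {-psi<..<psi}"
        using psi_pos by (intro eventually_at_in_open') auto
      moreover have "\<forall>\<^sub>F t in at (0::real). t \<noteq> 0" by (simp add: eventually_at_filter)
      ultimately show "\<forall>\<^sub>F t in at 0. norm (g t * prim h t) \<le> K * norm (prim h t /\<^sub>R t)"
      proof eventually_elim
        case (elim t)
        have "norm (g t * prim h t) = norm (of_real t * g t) * norm (prim h t /\<^sub>R t)"
          using elim by (simp add: norm_mult)
        also have "\<dots> \<le> K * norm (prim h t /\<^sub>R t)"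
          using elim by (intro mult_right_mono K) auto
        finally show ?case .
      qed
    qed
    then show ?thesis by (simp add: isCont_def)
  qed
  moreover have "isCont (\<lambda>t. g t * prim h t) t" if "t \<noteq> 0" for t
    using g that prim_cont by (auto simp: weight_def)
  ultimately have "continuous_on UNIV (\<lambda>t. g t * prim h t)"
    by (metis continuous_at_imp_continuous_on)
  then show ?thesis by (simp add: cont0_def)
qed

lemma weight_mult:
  assumes "continuous_on UNIV G" "weight g"
  shows "weight (\<lambda>t. G t * g t)"
proof -
  obtain K where K: "\<And>t. \<bar>t\<bar> \<le> psi \<Longrightarrow> norm (of_real t * g t) \<le> K"
    using assms by (auto simp: weight_def)
  have "compact (G ` {-psi..psi})"
    by (intro compact_continuous_image continuous_on_subset[OF assms(1)]) auto
  then obtain B where B: "\<And>t. \<bar>t\<bar> \<le> psi \<Longrightarrow> norm (G t) \<le> B"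
    by (force dest!: compact_imp_bounded simp: bounded_iff)
  have "norm (of_real t * (G t * g t)) \<le> B * K" if "\<bar>t\<bar> \<le> psi" for t
    using mult_mono[OF B[OF that] K[OF that]] order_trans[OF norm_ge_zero B[OF that]]
    by (simp add: norm_mult ac_simps)
  moreover have "isCont G t" for t
    using assms(1) by (simp add: continuous_on_eq_continuous_at)
  ultimately show ?thesis using assms(2) by (auto simp: weight_def intro!: continuous_intros)
qed

lemma weight_1: "weight (\<lambda>t. 1)"
  by (auto simp: weight_def)

lemma weight_continuous: "continuous_on UNIV G \<Longrightarrow> weight G"
  using weight_mult[OF _ weight_1, of G] by simp

lemma abs_le_abs_sinh: "\<bar>t\<bar> \<le> \<bar>sinh t\<bar>" for t :: real
  using real_le_abs_sinh[of t] by (simp add: sinh_field_def exp_minus)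

lemma weight_csch: "weight (\<lambda>t. of_real (csch t))"
proof -
  have "norm (of_real t * of_real (csch t) :: complex) \<le> 1" for t
    using abs_le_abs_sinh[of t] by (cases "t = 0") (auto simp: csch_def norm_mult norm_divide divide_simps)
  moreover have "isCont (\<lambda>t. of_real (csch t) :: complex) t" if "t \<noteq> 0" for t
    unfolding csch_def using that by (intro continuous_intros) auto
  ultimately show ?thesis by (auto simp: weight_def)
qed

lemma weight_coth: "weight (\<lambda>t. of_real (coth t))"
proof -
  have "continuous_on UNIV (\<lambda>t. of_real (cosh t) :: complex)" by (intro continuous_intros)
  from weight_mult[OF this weight_csch] show ?thesis by (simp add: coth_def csch_def)
qed

lemma weight_tanh: "weight (\<lambda>t. of_real (tanh t))"
  by (intro weight_continuous continuous_intros) auto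

text \<open>This is the derivative of \<open>iterated_integral (w @ [h]) 0\<close> in its upper
  limit. Working with it removes the \<open>d/dy\<close> of the theorem and turns concatenation of
  forms into composition of operators.\<close>

primrec nest :: "(real \<Rightarrow> complex) list \<Rightarrow> (real \<Rightarrow> complex) \<Rightarrow> real \<Rightarrow> complex" where
  "nest [] h = h"
| "nest (g # w) h = (\<lambda>t. g t * prim (nest w h) t)"

lemma nest_append: "nest (v @ w) h = nest v (nest w h)"
  by (induction v) auto

lemma iterated_integral_eq_prim: "iterated_integral (w @ [h]) 0 = prim (nest w h)"
  by (induction w) (auto simp: prim_def[abs_def])

lemma nest_cont0: "\<forall>g\<in>set w. weight g \<Longrightarrow> h \<in> cont0 \<Longrightarrow> nest w h \<in> cont0"
  by (induction w) (auto intro: weight_prim_cont0)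

lemma cont0_continuous: "h \<in> cont0 \<Longrightarrow> continuous_on UNIV h"
  by (simp add: cont0_def)

lemma nest_combine:
  assumes "\<forall>g\<in>set w. weight g" "u \<in> cont0" "v \<in> cont0"
  shows "nest w (\<lambda>t. a * u t + b * v t) = (\<lambda>t. a * nest w u t + b * nest w v t)"
  using assms(1)
proof (induction w)
  case (Cons g w)
  have "prim (\<lambda>t. a * nest w u t + b * nest w v t) t = a * prim (nest w u) t + b * prim (nest w v) t" for t
    by (rule prim_combine) (use Cons.prems assms nest_cont0 cont0_continuous in auto)
  then show ?case using Cons by (simp add: algebra_simps)
qed simp

text \<open>\<open>C\<close> depends on \<open>w\<close> alone. Applied to a sequence of functions
  with shrinking \<open>M\<close>, it transfers the rate of \<open>M\<close> to the nested
  integrals.\<close>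

lemma nest_bound:
  assumes "\<forall>g\<in>set w. weight g"
  shows "\<exists>C\<ge>0. \<forall>h\<in>cont0. \<forall>M\<ge>0. (\<forall>t. \<bar>t\<bar> \<le> psi \<longrightarrow> norm (h t) \<le> M * \<bar>t\<bar>) \<longrightarrow>
    (\<forall>t. \<bar>t\<bar> \<le> psi \<longrightarrow> norm (nest w h t) \<le> C * M * \<bar>t\<bar>)"
  using assms
proof (induction w)
  case Nil
  show ?case by (intro exI[of _ 1]) auto
next
  case (Cons g w)
  then obtain C where C: "C \<ge> 0" "\<And>h M t. h \<in> cont0 \<Longrightarrow> 0 \<le> M \<Longrightarrow>
     (\<forall>t. \<bar>t\<bar> \<le> psi \<longrightarrow> norm (h t) \<le> M * \<bar>t\<bar>) \<Longrightarrow> \<bar>t\<bar> \<le> psi \<Longrightarrow> norm (nest w h t) \<le> C * M * \<bar>t\<bar>"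
    by auto
  obtain K where K: "\<And>t. \<bar>t\<bar> \<le> psi \<Longrightarrow> norm (of_real t * g t) \<le> K"
    using Cons.prems by (auto simp: weight_def)
  have K0: "0 \<le> K" using K[of 0] psi_pos by simp
  have "norm (nest (g # w) h t) \<le> (K * C) * M * \<bar>t\<bar>"
    if h: "h \<in> cont0" "0 \<le> M" "\<forall>t. \<bar>t\<bar> \<le> psi \<longrightarrow> norm (h t) \<le> M * \<bar>t\<bar>" and t: "\<bar>t\<bar> \<le> psi" for h M t
  proof -
    have "norm (prim (nest w h) t) \<le> (C * M) * \<bar>t\<bar> * \<bar>t\<bar>"
      using Cons.prems h C(1)
      by (intro norm_prim_le[OF _ C(2)[OF h] _ t] cont0_continuous nest_cont0) auto
    then have "norm (nest (g # w) h t) \<le> norm (g t) * ((C * M) * \<bar>t\<bar> * \<bar>t\<bar>)"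
      by (simp add: norm_mult mult_left_mono)
    also have "\<dots> = norm (of_real t * g t) * (C * M * \<bar>t\<bar>)" by (simp add: norm_mult)
    also have "\<dots> \<le> K * (C * M * \<bar>t\<bar>)" using h C(1) by (intro mult_right_mono K t) auto
    finally show ?thesis by (simp add: ac_simps)
  qed
  then show ?case using C(1) K0 by (intro exI[of _ "K * C"]) auto
qed

text \<open>\<open>expr_apply A h\<close> is the integrand of the outermost integral in \<open>A \<circ> h dt\<close>; composition of
  expressions becomes composition of these operators.\<close>

definition expr_apply :: "form_expr \<Rightarrow> (real \<Rightarrow> complex) \<Rightarrow> real \<Rightarrow> complex" where
  "expr_apply A h t = (\<Sum>(c, w, G)\<leftarrow>A. c * nest w (\<lambda>u. G u * h u) t)"

definition admissible :: "form_expr \<Rightarrow> bool" where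
  "admissible A \<longleftrightarrow> (\<forall>(c, w, G)\<in>set A. (\<forall>g\<in>set w. weight g) \<and> continuous_on UNIV G)"

lemma expr_apply_Nil [simp]: "expr_apply [] h t = 0"
  and expr_apply_Cons: "expr_apply ((c, w, G) # A) h t = c * nest w (\<lambda>u. G u * h u) t + expr_apply A h t"
  by (simp_all add: expr_apply_def)

lemma admissible_Cons: "admissible ((c, w, G) # A) \<longleftrightarrow>
    (\<forall>g\<in>set w. weight g) \<and> continuous_on UNIV G \<and> admissible A"
  by (auto simp: admissible_def)

lemma zero_cont0: "(\<lambda>t. 0) \<in> cont0"
  by (simp add: cont0_def)

lemma expr_apply_cont0: "admissible A \<Longrightarrow> h \<in> cont0 \<Longrightarrow> expr_apply A h \<in> cont0"
proof (induction A)
  case Nil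
  then show ?case by (simp add: expr_apply_def[abs_def] zero_cont0)
next
  case (Cons x A)
  obtain c w G where x: "x = (c, w, G)" by (cases x) auto
  have "(\<lambda>t. c * nest w (\<lambda>u. G u * h u) t + 1 * expr_apply A h t) \<in> cont0"
    using Cons by (intro cont0_combine nest_cont0 mult_cont0) (auto simp: x admissible_Cons)
  then show ?case by (simp add: x expr_apply_Cons[abs_def])
qed

lemma expr_apply_combine:
  assumes "admissible A" "u \<in> cont0" "v \<in> cont0"
  shows "expr_apply A (\<lambda>t. a * u t + b * v t) = (\<lambda>t. a * expr_apply A u t + b * expr_apply A v t)"
  using assms(1)
proof (induction A)
  case (Cons x A)
  obtain c w G where x: "x = (c, w, G)" by (cases x) auto
  have "nest w (\<lambda>t. a * (G t * u t) + b * (G t * v t)) =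
      (\<lambda>t. a * nest w (\<lambda>t. G t * u t) t + b * nest w (\<lambda>t. G t * v t) t)"
    using Cons.prems assms by (intro nest_combine mult_cont0) (auto simp: x admissible_Cons)
  then have "nest w (\<lambda>t. G t * (a * u t + b * v t)) t =
      a * nest w (\<lambda>t. G t * u t) t + b * nest w (\<lambda>t. G t * v t) t" for t
    by (simp add: algebra_simps)
  moreover have "expr_apply A (\<lambda>t. a * u t + b * v t) t = a * expr_apply A u t + b * expr_apply A v t" for t
    using Cons by (simp add: x admissible_Cons)
  ultimately show ?case by (simp add: x expr_apply_Cons fun_eq_iff) (simp add: algebra_simps)
qed (simp add: fun_eq_iff)

lemma expr_apply_bound:
  assumes "admissible A"
  shows "\<exists>C\<ge>0. \<forall>h\<in>cont0. \<forall>M\<ge>0. (\<forall>t. \<bar>t\<bar> \<le> psi \<longrightarrow> norm (h t) \<le> M * \<bar>t\<bar>) \<longrightarrow>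
    (\<forall>t. \<bar>t\<bar> \<le> psi \<longrightarrow> norm (expr_apply A h t) \<le> C * M * \<bar>t\<bar>)"
  using assms
proof (induction A)
  case Nil
  show ?case by (intro exI[of _ 0]) auto
next
  case (Cons x A)
  obtain c w G where x: "x = (c, w, G)" by (cases x) auto
  obtain C where C: "C \<ge> 0" "\<And>h M t. h \<in> cont0 \<Longrightarrow> 0 \<le> M \<Longrightarrow>
     (\<forall>t. \<bar>t\<bar> \<le> psi \<longrightarrow> norm (h t) \<le> M * \<bar>t\<bar>) \<Longrightarrow> \<bar>t\<bar> \<le> psi \<Longrightarrow> norm (expr_apply A h t) \<le> C * M * \<bar>t\<bar>"
    using Cons by (auto simp: x admissible_Cons)
  obtain D where D: "D \<ge> 0" "\<And>h M t. h \<in> cont0 \<Longrightarrow> 0 \<le> M \<Longrightarrow>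
     (\<forall>t. \<bar>t\<bar> \<le> psi \<longrightarrow> norm (h t) \<le> M * \<bar>t\<bar>) \<Longrightarrow> \<bar>t\<bar> \<le> psi \<Longrightarrow> norm (nest w h t) \<le> D * M * \<bar>t\<bar>"
    using nest_bound[of w] Cons.prems by (auto simp: x admissible_Cons)
  have G: "continuous_on UNIV G" using Cons.prems by (simp add: x admissible_Cons)
  have "compact (G ` {-psi..psi})"
    by (intro compact_continuous_image continuous_on_subset[OF G]) auto
  then obtain B where B: "\<And>t. \<bar>t\<bar> \<le> psi \<Longrightarrow> norm (G t) \<le> B"
    by (force dest!: compact_imp_bounded simp: bounded_iff)
  have B0: "0 \<le> B" using order_trans[OF norm_ge_zero B[of 0]] psi_pos by simp
  have "norm (expr_apply (x # A) h t) \<le> (norm c * D * B + C) * M * \<bar>t\<bar>"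
    if h: "h \<in> cont0" "0 \<le> M" "\<forall>t. \<bar>t\<bar> \<le> psi \<longrightarrow> norm (h t) \<le> M * \<bar>t\<bar>" and t: "\<bar>t\<bar> \<le> psi" for h M t
  proof -
    have "norm (nest w (\<lambda>u. G u * h u) t) \<le> D * (B * M) * \<bar>t\<bar>"
    proof (rule D(2)[OF mult_cont0[OF G h(1)] _ _ t], goal_cases)
      case 2
      show ?case
      proof (intro allI impI)
        fix u assume "\<bar>u\<bar> \<le> psi"
        then show "norm (G u * h u) \<le> B * M * \<bar>u\<bar>"
          using mult_mono[OF B[of u] h(3)[rule_format, of u] B0] by (simp add: norm_mult mult.assoc)
      qed
    qed (use B0 h in auto)
    then have "norm (c * nest w (\<lambda>u. G u * h u) t) \<le> norm c * (D * (B * M) * \<bar>t\<bar>)"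
      by (simp add: norm_mult mult_left_mono)
    moreover have "norm (expr_apply A h t) \<le> C * M * \<bar>t\<bar>" by (rule C(2)[OF h t])
    ultimately show ?thesis
      unfolding x expr_apply_Cons by (intro norm_triangle_le) (simp add: algebra_simps)
  qed
  then show ?case using C(1) D(1) B0 by (intro exI[of _ "norm c * D * B + C"]) auto
qed

text \<open>\<open>nest v\<close> starts by multiplying with the first form of \<open>v\<close>, so
  an extra factor \<open>G\<close> can be merged into that form; for empty \<open>v\<close> it lands
  on \<open>H\<close> instead. These are the two clauses of \<open>absorb\<close>.\<close>

lemma nest_absorb:
  "nest (w @ fst (absorb G (v, H))) (\<lambda>u. snd (absorb G (v, H)) u * h u)
    = nest w (\<lambda>t. G t * nest v (\<lambda>u. H u * h u) t)"
  by (cases v) (auto simp: nest_append mult.assoc)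

lemma expr_apply_append: "expr_apply (A @ B) h t = expr_apply A h t + expr_apply B h t"
  by (simp add: expr_apply_def)

lemma expr_comp_Nil: "[] \<odot> B = []"
  and expr_comp_Cons: "((c, w, G) # A) \<odot> B = map (\<lambda>(c', vH).
      (c * c', w @ fst (absorb G vH), snd (absorb G vH))) B @ (A \<odot> B)"
  by (simp_all add: expr_comp_def)

text \<open>The only point that is not formal is distributing \<open>nest w\<close> over the
  summands of \<open>B\<close>. It rests on linearity of the integral, hence the continuity
  assumptions.\<close>

lemma expr_apply_comp_aux:
  assumes "\<forall>g\<in>set w. weight g" "continuous_on UNIV G" "admissible B" "h \<in> cont0"
  shows "expr_apply (map (\<lambda>(c', vH). (c * c', w @ fst (absorb G vH), snd (absorb G vH))) B) h t
    = c * nest w (\<lambda>u. G u * expr_apply B h u) t"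
  using assms(3)
proof (induction B)
  case Nil
  have "nest w (\<lambda>u. 0) = (\<lambda>t. 0)"
    using nest_combine[OF assms(1) zero_cont0 zero_cont0, of 0 0] by simp
  then show ?case by simp
next
  case (Cons x B)
  obtain d v H where x: "x = (d, v, H)" by (cases x) auto
  let ?p = "\<lambda>u. G u * nest v (\<lambda>u. H u * h u) u" and ?q = "\<lambda>u. G u * expr_apply B h u"
  have 1: "expr_apply (map (\<lambda>(c', vH). (c * c', w @ fst (absorb G vH), snd (absorb G vH))) (x # B)) h t
      = c * d * nest w ?p t + c * nest w ?q t"
    using Cons by (simp add: x expr_apply_Cons nest_absorb admissible_Cons del: absorb.simps)
  have 2: "(\<lambda>u. G u * expr_apply (x # B) h u) = (\<lambda>u. d * ?p u + 1 * ?q u)"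
    by (simp add: fun_eq_iff x expr_apply_Cons algebra_simps)
  have p: "?p \<in> cont0" and q: "?q \<in> cont0"
    using assms Cons.prems by (auto simp: x admissible_Cons intro!: mult_cont0 nest_cont0 expr_apply_cont0)
  show ?case
    unfolding 1 2 nest_combine[OF assms(1) p q] by (simp add: algebra_simps)
qed

lemma expr_apply_comp:
  assumes "admissible A" "admissible B" "h \<in> cont0"
  shows "expr_apply (A \<odot> B) h = expr_apply A (expr_apply B h)"
proof
  show "expr_apply (A \<odot> B) h t = expr_apply A (expr_apply B h) t" for t
    using assms(1)
  proof (induction A)
    case (Cons x A)
    obtain c w G where x: "x = (c, w, G)" by (cases x) auto
    show ?case
      using Cons assms(2,3)
      by (simp add: x expr_comp_Cons expr_apply_append expr_apply_comp_aux expr_apply_Cons[of c w G A] admissible_Cons)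
  qed (simp add: expr_comp_Nil)
qed

lemma admissible_comp:
  assumes "admissible A" "admissible B"
  shows "admissible (A \<odot> B)"
proof -
  have abs: "(\<forall>g\<in>set (fst (absorb G (v, H))). weight g) \<and> continuous_on UNIV (snd (absorb G (v, H)))"
    if "\<forall>g\<in>set v. weight g" "continuous_on UNIV G" "continuous_on UNIV H" for G v H
    using that by (cases v) (auto intro: weight_mult intro!: continuous_intros)
  show ?thesis
    unfolding admissible_def
  proof
    fix x assume "x \<in> set (A \<odot> B)"
    then obtain c w G c' v H where A: "(c, w, G) \<in> set A" and B: "(c', v, H) \<in> set B"
      and x: "x = (c * c', w @ fst (absorb G (v, H)), snd (absorb G (v, H)))"
      by (auto simp: expr_comp_def simp del: absorb.simps)
    have "\<forall>g\<in>set w. weight g" "continuous_on UNIV G" "\<forall>g\<in>set v. weight g" "continuous_on UNIV H"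
      using A B assms unfolding admissible_def by blast+
    with abs[of v G H] show "case x of (c, w, G) \<Rightarrow> (\<forall>g\<in>set w. weight g) \<and> continuous_on UNIV G"
      by (auto simp: x simp del: absorb.simps)
  qed
qed

lemma expr_integral_eq_prim:
  assumes "admissible A" "h \<in> cont0"
  shows "expr_integral 0 y A h = prim (expr_apply A h) y"
  using assms(1)
proof (induction A)
  case Nil
  then show ?case by (simp add: expr_integral_def expr_apply_def[abs_def] prim_def)
next
  case (Cons x A)
  obtain c w G where x: "x = (c, w, G)" by (cases x) auto
  have "(\<lambda>t. nest w (\<lambda>u. G u * h u) t) \<in> cont0" "expr_apply A h \<in> cont0"
    using Cons.prems assms by (auto simp: x admissible_Cons intro!: nest_cont0 mult_cont0 expr_apply_cont0)
  then have "prim (\<lambda>t. c * nest w (\<lambda>u. G u * h u) t + 1 * expr_apply A h t) y =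
     c * prim (nest w (\<lambda>u. G u * h u)) y + 1 * prim (expr_apply A h) y"
    by (intro prim_combine cont0_continuous)
  then show ?case
    using Cons by (simp add: x expr_integral_def expr_apply_Cons[abs_def] iterated_integral_eq_prim admissible_Cons)
qed

section \<open>Central binomial coefficients\<close>

text \<open>\<open>a_coeff\<close> carries this number and \<open>b_coeff\<close> its inverse. It
  behaves like \<open>1 / sqrt (pi * m)\<close>, the source of the exponent 1/2 in the error
  rate.\<close>

definition central :: "nat \<Rightarrow> real" where
  "central m = real ((2 * m) choose m) / 4 ^ m"

lemma central_0 [simp]: "central 0 = 1"
  by (simp add: central_def)

lemma central_pos: "0 < central m"
  by (simp add: central_def)

lemma central_nonzero [simp]: "central m \<noteq> 0"
  using central_pos[of m] by simp

lemma central_Suc: "central (Suc m) = central m * (2 * real m + 1) / (2 * real m + 2)"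
proof -
  have "real ((2 * m) choose m) = fact (2 * m) / (fact m * fact m)" for m
    by (subst binomial_fact) (auto simp: mult_2)
  then have eq: "central m = fact (2 * m) / (fact m * fact m * 4 ^ m)" for m
    by (simp add: central_def)
  have "fact (2 * Suc m) = (2 * real m + 2) * (2 * real m + 1) * fact (2 * m)"
    by (simp add: algebra_simps)
  moreover have "fact (Suc m) = (real m + 1) * fact m"
    by (simp add: algebra_simps)
  ultimately show ?thesis
    unfolding eq by (simp add: divide_simps) (simp add: algebra_simps)
qed

text \<open>Squaring keeps the recurrence rational. The first product decreases in \<open>m\<close>,
  the second increases, and both equal \<open>1\<close> at \<open>m = 0\<close>.\<close>

lemma central_bounds: "(central m)\<^sup>2 * (2 * real m + 1) \<le> 1" "1 \<le> (central m)\<^sup>2 * (4 * real m + 1)"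
proof -
  \<comment> \<open>Used with \<open>a = 2 * m\<close>; it amounts to
    \<open>(a + 1) * (a + 3) \<le> (a + 2)^2\<close>.\<close>
  have upper: "(a + 1)\<^sup>2 / (a + 2)\<^sup>2 * (a + 3) \<le> a + 1" if "a \<ge> 0" for a :: real
    using that by (simp add: divide_simps) (simp add: algebra_simps power2_eq_square)
  have square: "(central (Suc m))\<^sup>2 = (central m)\<^sup>2 * ((2 * real m + 1)\<^sup>2 / (2 * real m + 2)\<^sup>2)" for m
    by (simp add: central_Suc power_mult_distrib power_divide)
  have shift: "2 * real (Suc m) + 1 = 2 * real m + 3" "4 * real (Suc m) + 1 = 4 * real m + 5" for m
    by simp_all
  show "(central m)\<^sup>2 * (2 * real m + 1) \<le> 1"
  proof (induction m)
    case (Suc m)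
    have "(central (Suc m))\<^sup>2 * (2 * real (Suc m) + 1)
        = (central m)\<^sup>2 * ((2 * real m + 1)\<^sup>2 / (2 * real m + 2)\<^sup>2 * (2 * real m + 3))"
      by (simp only: square shift mult.assoc)
    also have "\<dots> \<le> (central m)\<^sup>2 * (2 * real m + 1)"
      using upper[of "2 * real m"] by (intro mult_left_mono) auto
    finally show ?case using Suc by simp
  qed simp
  \<comment> \<open>After clearing denominators the two sides differ by exactly
    \<open>1\<close>.\<close>
  have lower: "2 * a + 1 \<le> (a + 1)\<^sup>2 / (a + 2)\<^sup>2 * (2 * a + 5)" if "a \<ge> 0" for a :: real
    using that by (simp add: divide_simps) (simp add: algebra_simps power2_eq_square)
  show "1 \<le> (central m)\<^sup>2 * (4 * real m + 1)"
  proof (induction m)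
    case (Suc m)
    have "(central m)\<^sup>2 * (4 * real m + 1)
        \<le> (central m)\<^sup>2 * ((2 * real m + 1)\<^sup>2 / (2 * real m + 2)\<^sup>2 * (4 * real m + 5))"
      using lower[of "2 * real m"] by (intro mult_left_mono) auto
    also have "\<dots> = (central (Suc m))\<^sup>2 * (4 * real (Suc m) + 1)"
      by (simp only: square shift mult.assoc)
    finally show ?case using Suc by simp
  qed simp
qed

lemma central_le: "central m \<le> 1 / sqrt (real m + 1)"
proof (rule power2_le_imp_le)
  have "(central m)\<^sup>2 * (real m + 1) \<le> (central m)\<^sup>2 * (2 * real m + 1)"
    by (intro mult_left_mono) auto
  also note central_bounds(1)
  finally show "(central m)\<^sup>2 \<le> (1 / sqrt (real m + 1))\<^sup>2"
    by (simp add: power_divide divide_simps)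
qed simp

text \<open>The left side is the value of the primitive of
  \<open>sinh ^ (2 * m) * cosh / central m\<close> where \<open>sinh = 1\<close>. Growth
  \<open>sqrt m\<close> of the inverse against the factor \<open>2 * m + 1\<close> leaves decay of
  order \<open>1 / sqrt m\<close>; the constant \<open>2\<close> is convenient, not sharp.\<close>

lemma inverse_central_le: "1 / (central m * (2 * real m + 1)) \<le> 2 / sqrt (real m + 1)"
proof (rule power2_le_imp_le)
  have "(central m)\<^sup>2 * ((4 * real m + 1) * (real m + 1)) \<le> (central m)\<^sup>2 * (4 * (2 * real m + 1)\<^sup>2)"
    by (intro mult_left_mono) (auto simp: power2_eq_square algebra_simps)
  moreover have "1 * (real m + 1) \<le> (central m)\<^sup>2 * (4 * real m + 1) * (real m + 1)"
    by (intro mult_right_mono central_bounds) auto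
  ultimately have "real m + 1 \<le> (central m)\<^sup>2 * (4 * (2 * real m + 1)\<^sup>2)"
    unfolding mult.assoc mult_1 by (rule order_trans[rotated])
  then show "(1 / (central m * (2 * real m + 1)))\<^sup>2 \<le> (2 / sqrt (real m + 1))\<^sup>2"
    using central_pos[of m] by (simp add: power_divide power_mult_distrib divide_simps)
qed simp

text \<open>Each term \<open>1 / (2 * (N + 1))\<close> is at most \<open>1 / (N + 2)\<close>, which
  lies below the increment of \<open>ln\<close> by \<open>ln x \<le> x - 1\<close> at
  \<open>x = (N + 1) / (N + 2)\<close>.\<close>

lemma half_harmonic_le: "(\<Sum>m=1..N. 1 / (2 * real m)) \<le> ln (real N + 1)"
proof (induction N)
  case (Suc N)
  have "ln ((real N + 1) / (real N + 2)) \<le> (real N + 1) / (real N + 2) - 1"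
    by (intro ln_le_minus_one) auto
  then have "1 / (real N + 2) \<le> ln (real N + 2) - ln (real N + 1)"
    by (simp add: ln_div field_simps)
  moreover have "1 / (2 * real (Suc N)) \<le> 1 / (real N + 2)"
    by (intro divide_left_mono) auto
  ultimately have "1 / (2 * real (Suc N)) \<le> ln (real N + 2) - ln (real N + 1)"
    by (rule order_trans[rotated])
  then show ?case using Suc by (simp add: add.commute)
qed simp

lemma error_rate_tendsto:
  "(\<lambda>N. 1 / sqrt (real N + 1) * (1 + (\<Sum>m=1..N. 1 / (2 * real m))) ^ d) \<longlonglongrightarrow> 0"
proof (rule tendsto_sandwich[of "\<lambda>_. 0"])
  show "(\<lambda>N. 1 / sqrt (real N + 1) * (1 + ln (real N + 1)) ^ d) \<longlonglongrightarrow> 0"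
    by real_asymp
  show "\<forall>\<^sub>F N in sequentially. 1 / sqrt (real N + 1) * (1 + (\<Sum>m=1..N. 1 / (2 * real m))) ^ d
      \<le> 1 / sqrt (real N + 1) * (1 + ln (real N + 1)) ^ d"
    by (intro always_eventually allI mult_left_mono power_mono add_left_mono half_harmonic_le)
      (auto intro!: add_nonneg_nonneg sum_nonneg)
  show "\<forall>\<^sub>F N in sequentially. 0 \<le> 1 / sqrt (real N + 1) * (1 + (\<Sum>m=1..N. 1 / (2 * real m))) ^ d"
    by (intro always_eventually allI mult_nonneg_nonneg zero_le_power add_nonneg_nonneg sum_nonneg) auto
qed simp

section \<open>The telescoping identities\<close>

lemma imaginary_even_power: "(\<i> * of_real x) ^ (2 * m) = of_real ((- 1) ^ m * x ^ (2 * m))"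
  by (simp add: power_mult_distrib power_mult) (simp add: power_minus[of "(of_real x)\<^sup>2"])

lemma a_coeff_sinh: "a_coeff m (\<i> * of_real x) = of_real ((- 1) ^ m * central m * x ^ (2 * m))"
  by (simp add: a_coeff_def imaginary_even_power central_def)

lemma b_coeff_sinh: "b_coeff m (\<i> * of_real x) = of_real ((- 1) ^ m / central m * x ^ (2 * m))"
  by (simp add: b_coeff_def imaginary_even_power central_def)

lemma prim_of_real:
  assumes "continuous_on UNIV f" "\<And>t. (F has_real_derivative f t) (at t)"
  shows "prim (\<lambda>u. of_real (f u)) t = of_real (F t - F 0)"
  using assms
  by (subst prim_eqI[where F = "\<lambda>t. of_real (F t)"])
    (auto intro!: continuous_intros has_vector_derivative_of_real
      simp flip: has_real_derivative_iff_has_vector_derivative)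

abbreviation tanh_c :: "real \<Rightarrow> complex" where "tanh_c \<equiv> \<lambda>t. of_real (tanh t)"
abbreviation coth_c :: "real \<Rightarrow> complex" where "coth_c \<equiv> \<lambda>t. of_real (coth t)"
abbreviation csch_c :: "real \<Rightarrow> complex" where "csch_c \<equiv> \<lambda>t. of_real (csch t)"
abbreviation sech_c :: "real \<Rightarrow> complex" where "sech_c \<equiv> \<lambda>t. of_real (sech t)"

text \<open>Even powers of \<open>sinh\<close> with positive exponent are eigenfunctions of
  multiplying by \<open>coth\<close> and integrating. The eigenvalue \<open>1 / (2 * Suc m)\<close>
  is where the denominators of the series come from. The positive exponent also makes the default
  value \<open>coth 0 = 0\<close> harmless.\<close>

lemma prim_coth_power:
  "prim (\<lambda>u. coth_c u * of_real (c * sinh u ^ (2 * Suc m))) t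
    = of_real (c * sinh t ^ (2 * Suc m)) / (2 * of_nat (Suc m))"
proof -
  have "coth u * (c * sinh u ^ (2 * Suc m)) = c * cosh u * sinh u ^ (2 * m + 1)" for u
    by (cases "u = 0") (auto simp: coth_def)
  then have eq: "(\<lambda>u. coth_c u * of_real (c * sinh u ^ (2 * Suc m)))
      = (\<lambda>u. of_real (c * cosh u * sinh u ^ (2 * m + 1)))"
    by (simp only: flip: of_real_mult)
  have "prim (\<lambda>u. of_real (c * cosh u * sinh u ^ (2 * m + 1))) t
      = of_real (c * sinh t ^ (2 * Suc m) / (2 * real (Suc m)) - c * sinh 0 ^ (2 * Suc m) / (2 * real (Suc m)))"
  proof (rule prim_of_real)
    show "((\<lambda>t. c * sinh t ^ (2 * Suc m) / (2 * real (Suc m))) has_real_derivative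
        c * cosh t * sinh t ^ (2 * m + 1)) (at t)" for t
      by (rule derivative_eq_intros refl | simp add: divide_simps)+
  qed (intro continuous_intros)
  then show ?thesis unfolding eq by simp
qed

lemma nest_coth_power:
  "nest (replicate j coth_c) (\<lambda>u. coth_c u * of_real (c * sinh u ^ (2 * Suc m)))
    = (\<lambda>u. coth_c u * of_real (c * sinh u ^ (2 * Suc m)) / (2 * of_nat (Suc m)) ^ j)"
proof (induction j)
  case (Suc j)
  have "prim (\<lambda>u. coth_c u * of_real (c * sinh u ^ (2 * Suc m)) / (2 * of_nat (Suc m)) ^ j) t
      = of_real (c * sinh t ^ (2 * Suc m)) / (2 * of_nat (Suc m)) ^ Suc j" for t
    unfolding prim_divide prim_coth_power by (simp add: ac_simps del: of_nat_Suc)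
  then show ?case by (simp only: replicate_Suc nest.simps Suc times_divide_eq_right)
qed simp

section \<open>The operators of \<open>p_tilde\<close> and the \<alpha> identity\<close>

lemma absorb_1: "absorb (\<lambda>t. 1) (w, H) = (w, H)"
  by (cases w) auto

lemma expr_comp_1: "[(1, v, \<lambda>t. 1)] \<odot> [(c, w, H)] = [(c, v @ w, H)]"
  by (simp add: expr_comp_def absorb_1)

lemma expr_power_form: "expr_power (form f) k = [(1, replicate k (\<lambda>t. of_real (f t)), \<lambda>t. 1)]"
proof (induction k)
  case (Suc k)
  then show ?case by (simp add: form_def expr_comp_1)
qed (simp add: expr_one_def func_def)

lemma p_tilde_eq: "p_tilde k =
    [(1, tanh_c # replicate (k - 1) coth_c, \<lambda>t. 1),
     (- 1, tanh_c # replicate (k - 1) coth_c @ [csch_c], sech_c)]"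
  unfolding p_tilde_def expr_power_form
  by (simp add: form_def func_def expr_one_def expr_diff_def expr_comp_def absorb_1)

lemma admissible_p_tilde: "admissible (p_tilde k)"
proof -
  have "continuous_on UNIV sech_c" unfolding sech_def by (intro continuous_intros) auto
  then show ?thesis
    by (auto simp: p_tilde_eq admissible_def weight_tanh weight_coth weight_csch)
qed

text \<open>Both summands of \<open>p_tilde\<close> share their outer forms. Pulling these out
  isolates \<open>h - csch * prim (sech * h)\<close>, the combination in which the cancellation of
  \<open>a_form_step\<close> takes place.\<close>

lemma expr_apply_p_tilde:
  assumes "h \<in> cont0"
  shows "expr_apply (p_tilde k) h =
    nest (tanh_c # replicate (k - 1) coth_c) (\<lambda>t. h t - csch_c t * prim (\<lambda>u. sech_c u * h u) t)"
proof -
  have "continuous_on UNIV sech_c" unfolding sech_def by (intro continuous_intros) auto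
  then have v: "(\<lambda>t. csch_c t * prim (\<lambda>u. sech_c u * h u) t) \<in> cont0"
    by (intro weight_prim_cont0 weight_csch mult_cont0 assms)
  have w: "\<forall>g\<in>set (tanh_c # replicate (k - 1) coth_c). weight g"
    by (auto simp: weight_tanh weight_coth)
  have "expr_apply (p_tilde k) h t = 1 * nest (tanh_c # replicate (k - 1) coth_c) h t
      + (- 1) * nest (tanh_c # replicate (k - 1) coth_c) (\<lambda>t. csch_c t * prim (\<lambda>u. sech_c u * h u) t) t" for t
    by (simp add: p_tilde_eq expr_apply_Cons nest_append del: nest.simps(2))
       (simp add: nest_append)
  then show ?thesis
    using nest_combine[OF w assms v, of 1 "- 1"] by (simp add: fun_eq_iff)
qed

definition a_form :: "nat \<Rightarrow> real \<Rightarrow> complex" where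
  "a_form m t = a_coeff m (\<i> * of_real (sinh t)) * of_real (tanh t)"

definition b_form :: "nat \<Rightarrow> real \<Rightarrow> complex" where
  "b_form m t = b_coeff m (\<i> * of_real (sinh t))"

lemma a_form_cont0: "a_form m \<in> cont0"
  by (auto simp: cont0_def a_form_def[abs_def] a_coeff_sinh intro!: continuous_intros)

lemma b_form_continuous: "continuous_on UNIV (b_form m)"
  by (auto simp: b_form_def[abs_def] b_coeff_sinh intro!: continuous_intros)

text \<open>On the difference of consecutive \<alpha> integrands the inner combination collapses to
  \<open>coth * A' * sinh ^ (2 * Suc m)\<close>. This \<open>coth\<close> and the
  \<open>k - 1\<close> of \<open>p_tilde\<close> give \<open>k\<close> eigenvalue factors, and the
  leading \<open>tanh\<close> restores \<open>a_form\<close>.\<close>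

lemma a_form_step:
  assumes "1 \<le> k"
  shows "expr_apply (p_tilde k) (a_form (Suc m)) t - expr_apply (p_tilde k) (a_form m) t
    = a_form (Suc m) t / (2 * of_nat (Suc m)) ^ k"
proof -
  define A where "A = (- 1) ^ m * central m"
  define A' where "A' = (- 1) ^ Suc m * central (Suc m)"
  have A': "A' = - A * (2 * real m + 1) / (2 * real m + 2)"
    by (simp add: A_def A'_def central_Suc)
  define h where "h = (\<lambda>t. a_form (Suc m) t - a_form m t)"
  have h: "h t = of_real (tanh t * (A' * sinh t ^ (2 * m + 2) - A * sinh t ^ (2 * m)))" for t
    unfolding h_def a_form_def a_coeff_sinh A_def[symmetric] A'_def[symmetric] by (simp add: algebra_simps)
  have prim: "prim (\<lambda>u. sech_c u * h u) t
      = of_real (- (A / (2 * real m + 2)) * sinh t ^ (2 * m + 2) / cosh t)" for t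
  proof -
    \<comment> \<open>With \<open>x = sinh t\<close>, \<open>c = cosh t\<close>, the derivative of
      \<open>x ^ (2 * m + 2) / c\<close> has the factor
      \<open>(2 * m + 2) * c^2 - x^2 = (2 * m + 1) * x^2 + 2 * m + 2\<close>. By the recurrence for
      \<open>A'\<close> this is proportional to \<open>A' * x^2 - A\<close>, and
      \<open>- A / (2 * m + 2)\<close> is the ratio.\<close>
    let ?F = "\<lambda>t. - (A / (2 * real m + 2)) * sinh t ^ (2 * m + 2) / cosh t"
    have "prim (\<lambda>u. of_real (sech u * (tanh u * (A' * sinh u ^ (2 * m + 2) - A * sinh u ^ (2 * m))))) t
        = of_real (?F t - ?F 0)"
    proof (rule prim_of_real)
      show "continuous_on UNIV (\<lambda>u. sech u * (tanh u * (A' * sinh u ^ (2 * m + 2) - A * sinh u ^ (2 * m))))"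
        unfolding sech_def by (intro continuous_intros) auto
      fix t :: real
      define x c where "x = sinh t" and "c = cosh t"
      have c: "c > 0" "c * c = x * x + 1"
        using cosh_square_eq[of t] by (auto simp: x_def c_def power2_eq_square)
      have "(?F has_real_derivative
          (- (A / (2 * real m + 2)) * (real (2 * m + 2) * x ^ (2 * m + 1) * c) * c
            - - (A / (2 * real m + 2)) * x ^ (2 * m + 2) * x) / (c * c)) (at t)"
        unfolding x_def c_def by (rule derivative_eq_intros refl | simp)+
      also have "(- (A / (2 * real m + 2)) * (real (2 * m + 2) * x ^ (2 * m + 1) * c) * c
            - - (A / (2 * real m + 2)) * x ^ (2 * m + 2) * x) / (c * c)
         = x ^ (2 * m) * x * (- A * (c * c) + A / (2 * real m + 2) * (x * x)) / (c * c)"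
        by (simp add: divide_simps) (simp add: algebra_simps)
      also have "- A * (c * c) + A / (2 * real m + 2) * (x * x) = A' * (x * x) - A"
        unfolding A' c(2) by (simp add: divide_simps) (simp add: algebra_simps)
      also have "x ^ (2 * m) * x * (A' * (x * x) - A) / (c * c)
          = sech t * (tanh t * (A' * sinh t ^ (2 * m + 2) - A * sinh t ^ (2 * m)))"
        by (simp add: sech_def tanh_def x_def[symmetric] c_def[symmetric] algebra_simps diff_divide_distrib)
      finally show "(?F has_real_derivative
          sech t * (tanh t * (A' * sinh t ^ (2 * m + 2) - A * sinh t ^ (2 * m)))) (at t)" .
    qed
    then show ?thesis by (simp add: h)
  qed
  have inner: "h t - csch_c t * prim (\<lambda>u. sech_c u * h u) t = coth_c t * of_real (A' * sinh t ^ (2 * Suc m))" for t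
  \<comment> \<open>At \<open>0\<close> both sides vanish: \<open>tanh 0 = 0\<close>,
    \<open>csch 0\<close> has the default value \<open>0\<close>, and the power of
    \<open>sinh\<close> on the right is positive.\<close>
  proof (cases "t = 0")
    case True
    then show ?thesis by (simp add: h csch_def)
  next
    case False
    define x c where "x = sinh t" and "c = cosh t"
    have c: "c > 0" "c * c = x * x + 1" and x: "x \<noteq> 0"
      using cosh_square_eq[of t] False by (auto simp: x_def c_def power2_eq_square)
    have "tanh t * (A' * sinh t ^ (2 * m + 2) - A * sinh t ^ (2 * m))
        - csch t * (- (A / (2 * real m + 2)) * sinh t ^ (2 * m + 2) / cosh t)
      = x ^ (2 * m) * x / c * (A' * (x * x) + (- A + A / (2 * real m + 2)))"
      using c x by (simp add: tanh_def csch_def x_def[symmetric] c_def[symmetric] divide_simps)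
        (simp add: algebra_simps)
    \<comment> \<open>The recurrence enters a second time: it gives both terms the coefficient
      \<open>A'\<close>, so that \<open>x * x + 1\<close> becomes \<open>c * c\<close> and cancels
      the denominator.\<close>
    also have "- A + A / (2 * real m + 2) = A'"
      unfolding A' by (simp add: divide_simps) (simp add: algebra_simps)
    also have "A' * (x * x) + A' = A' * (c * c)" unfolding c(2) by (simp add: algebra_simps)
    also have "x ^ (2 * m) * x / c * (A' * (c * c)) = coth t * (A' * sinh t ^ (2 * Suc m))"
      using c(1) x by (simp add: coth_def ac_simps flip: x_def c_def)
    finally show ?thesis
      unfolding prim unfolding h by (simp only: flip: of_real_mult of_real_diff)
  qed
  have hZ: "h \<in> cont0"
    using cont0_combine[OF a_form_cont0[of "Suc m"] a_form_cont0[of m], of 1 "- 1"] by (simp add: h_def)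
  have "expr_apply (p_tilde k) (a_form (Suc m)) t - expr_apply (p_tilde k) (a_form m) t = expr_apply (p_tilde k) h t"
    using expr_apply_combine[OF admissible_p_tilde a_form_cont0[of "Suc m"] a_form_cont0[of m], of k 1 "- 1"]
    by (simp add: h_def)
  also have "\<dots> = tanh_c t * prim (\<lambda>u. coth_c u * of_real (A' * sinh u ^ (2 * Suc m)) / (2 * of_nat (Suc m)) ^ (k - 1)) t"
    by (simp only: expr_apply_p_tilde[OF hZ] inner nest_coth_power nest.simps)
  also have "\<dots> = tanh_c t * (of_real (A' * sinh t ^ (2 * Suc m)) / (2 * of_nat (Suc m)) / (2 * of_nat (Suc m)) ^ (k - 1))"
    by (simp only: prim_divide prim_coth_power)
  also have "\<dots> = a_form (Suc m) t / (2 * of_nat (Suc m)) ^ Suc (k - 1)"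
    unfolding a_form_def a_coeff_sinh A'_def by (simp add: ac_simps del: of_nat_Suc)
  finally show ?thesis using assms by simp
qed

section \<open>The operators of \<open>g_tilde\<close> and the \<sigma> identity\<close>

definition g_weights :: "nat \<Rightarrow> (real \<Rightarrow> complex) list" where
  "g_weights k = (if k = 1 then [tanh_c] else (\<lambda>t. 1) # replicate (k - 2) coth_c @ [\<lambda>t. 1])"

lemma g_tilde_eq: "g_tilde k = [(1, g_weights k, \<lambda>t. 1)]"
  unfolding g_tilde_def g_weights_def expr_power_form by (simp add: form_def expr_comp_1)

lemma g_prod_eq: "expr_prod (map g_tilde s) = [(1, concat (map g_weights s), \<lambda>t. 1)]"
  by (induction s) (simp_all add: expr_prod_def g_tilde_eq expr_comp_1 expr_one_def func_def)

lemma nest_concat: "nest (concat (map g_weights s)) h = foldr (\<lambda>k. nest (g_weights k)) s h"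
  by (induction s) (simp_all add: nest_append)

text \<open>A single integration turns the difference into
  \<open>coth * b_form (Suc m) / (2 * Suc m)\<close>. For \<open>k = 1\<close> the
  \<open>tanh\<close> cancels this \<open>coth\<close>; for \<open>k \<ge> 2\<close> it joins the
  \<open>k - 2\<close> others, and together they supply the remaining \<open>k - 1\<close>
  eigenvalue factors.\<close>

lemma b_form_step:
  assumes "1 \<le> k"
  shows "nest (g_weights k) (\<lambda>t. b_form (Suc m) t - b_form m t) t
    = b_form (Suc m) t / (2 * of_nat (Suc m)) ^ k"
proof -
  define B where "B = (- 1) ^ m / central m"
  define B' where "B' = (- 1) ^ Suc m / central (Suc m)"
  have B': "B' = - B * (2 * real m + 2) / (2 * real m + 1)"
    using central_pos[of m] by (simp add: B_def B'_def central_Suc)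
  define h where "h = (\<lambda>t. b_form (Suc m) t - b_form m t)"
  have h: "h t = of_real (B' * sinh t ^ (2 * m + 2) - B * sinh t ^ (2 * m))" for t
    unfolding h_def b_form_def b_coeff_sinh B_def[symmetric] B'_def[symmetric] by simp
  let ?N = "2 * of_nat (Suc m) :: complex"
  have b: "b_form (Suc m) t = of_real (B' * sinh t ^ (2 * Suc m))" for t
    unfolding b_form_def b_coeff_sinh B'_def ..
  have prim: "prim h t = coth_c t * of_real (B' * sinh t ^ (2 * Suc m)) / ?N" for t
  proof -
    \<comment> \<open>The derivative of \<open>sinh ^ (2 * m + 1) * cosh\<close> is \<open>(2 * m +
      2) * sinh ^ (2 * m + 2) + (2 * m + 1) * sinh ^ (2 * m)\<close>, and the recurrence for
      \<open>B'\<close> matches these two coefficients with \<open>B'\<close> and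
      \<open>- B\<close>.\<close>
    let ?F = "\<lambda>t. B' / (2 * real m + 2) * sinh t ^ (2 * m + 1) * cosh t"
    have "h = (\<lambda>u. of_real (B' * sinh u ^ (2 * m + 2) - B * sinh u ^ (2 * m)))"
      by (rule ext) (rule h)
    moreover have "prim (\<lambda>u. of_real (B' * sinh u ^ (2 * m + 2) - B * sinh u ^ (2 * m))) t = of_real (?F t - ?F 0)"
    proof (rule prim_of_real)
      fix t :: real
      define x c where "x = sinh t" and "c = cosh t"
      have c: "c * c = x * x + 1"
        using cosh_square_eq[of t] by (auto simp: x_def c_def power2_eq_square)
      have "(?F has_real_derivative
          B' / (2 * real m + 2) * (real (2 * m + 1) * x ^ (2 * m) * c) * c
            + x * (B' / (2 * real m + 2) * x ^ (2 * m + 1))) (at t)"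
        unfolding x_def c_def by (rule derivative_eq_intros refl | simp)+
      also have "B' / (2 * real m + 2) * (real (2 * m + 1) * x ^ (2 * m) * c) * c
            + x * (B' / (2 * real m + 2) * x ^ (2 * m + 1))
          = x ^ (2 * m) * B' / (2 * real m + 2) * ((2 * real m + 1) * (c * c) + x * x)"
        by (simp add: algebra_simps add_divide_distrib)
      also have "\<dots> = B' * x ^ (2 * m + 2) - B * x ^ (2 * m)"
        unfolding c B' by (simp add: divide_simps) (simp add: algebra_simps)
      finally show "(?F has_real_derivative B' * sinh t ^ (2 * m + 2) - B * sinh t ^ (2 * m)) (at t)"
        by (simp add: x_def)
    qed (intro continuous_intros)
    moreover have "?F t - ?F 0 = coth t * (B' * sinh t ^ (2 * Suc m)) / (2 * real (Suc m))"
      by (cases "t = 0") (auto simp: coth_def ac_simps)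
    ultimately have "prim h t = of_real (coth t * (B' * sinh t ^ (2 * Suc m)) / (2 * real (Suc m)))"
      by (simp only:)
    then show ?thesis by simp
  qed
  have "nest (g_weights k) h t = b_form (Suc m) t / ?N ^ k"
  proof (cases "k = 1")
    case True
    have "tanh_c t * (coth_c t * of_real (B' * sinh t ^ (2 * Suc m))) = of_real (B' * sinh t ^ (2 * Suc m))"
      by (cases "t = 0") (auto simp: coth_def tanh_def)
    moreover have "g_weights k = [tanh_c]" using True by (simp add: g_weights_def)
    ultimately show ?thesis
      using True by (simp only: nest.simps prim b times_divide_eq_right power_one_right)
  next
    case False
    then have k: "k = Suc (Suc (k - 2))" using assms by simp
    have "nest (replicate (k - 2) coth_c @ [\<lambda>t. 1]) h
        = nest (replicate (k - 2) coth_c) (\<lambda>t. coth_c t * of_real (B' / (2 * real (Suc m)) * sinh t ^ (2 * Suc m)))"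
      by (simp add: nest_append prim)
    also have "\<dots> = (\<lambda>t. coth_c t * of_real (B' / (2 * real (Suc m)) * sinh t ^ (2 * Suc m)) / ?N ^ (k - 2))"
      by (rule nest_coth_power)
    finally have "nest (g_weights k) h t
        = prim (\<lambda>t. coth_c t * of_real (B' / (2 * real (Suc m)) * sinh t ^ (2 * Suc m)) / ?N ^ (k - 2)) t"
      using False by (simp add: g_weights_def)
    also have "\<dots> = of_real (B' / (2 * real (Suc m)) * sinh t ^ (2 * Suc m)) / ?N / ?N ^ (k - 2)"
      by (simp only: prim_divide prim_coth_power)
    also have "\<dots> = b_form (Suc m) t / ?N ^ Suc (Suc (k - 2))"
      by (simp add: b ac_simps del: of_nat_Suc)
    finally show ?thesis by (simp only: k[symmetric])
  qed
  then show ?thesis by (simp add: h_def)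
qed

section \<open>Bounds and convergence\<close>

lemma abs_tanh_le: "\<bar>tanh t\<bar> \<le> \<bar>t\<bar>" for t :: real
proof -
  have "norm (tanh t - tanh 0) \<le> 1 * norm (t - 0)"
  proof (rule field_differentiable_bound[where S = UNIV])
    show "(tanh has_field_derivative 1 - (tanh z)\<^sup>2) (at z within UNIV)" for z :: real
      by (rule derivative_eq_intros refl | simp)+
    show "norm (1 - (tanh z)\<^sup>2) \<le> 1" for z :: real
      using tanh_real_bounds[of z] by (simp add: abs_square_le_1 abs_le_iff)
  qed auto
  then show ?thesis by simp
qed

lemma abs_sinh_le_1: "\<bar>t\<bar> \<le> psi \<Longrightarrow> \<bar>sinh t\<bar> \<le> 1"
  using sinh_real_le_iff[of "\<bar>t\<bar>" psi] by (simp add: psi_def del: sinh_real_le_iff)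

text \<open>Here \<open>cosh^2 = 1 + sinh^2 \<le> 2\<close>, so \<open>2\<close> is a generous bound
  for \<open>cosh\<close> in \<open>sinh = tanh * cosh\<close>.\<close>

lemma abs_sinh_le: assumes "\<bar>t\<bar> \<le> psi" shows "\<bar>sinh t\<bar> \<le> 2 * \<bar>t\<bar>"
proof -
  have "(sinh t)\<^sup>2 \<le> 1"
    using abs_sinh_le_1[OF assms] by (simp add: abs_square_le_1)
  then have "(cosh t)\<^sup>2 \<le> 2\<^sup>2" by (simp add: cosh_square_eq)
  then have "cosh t \<le> 2" by (rule power2_le_imp_le) simp
  then have "\<bar>tanh t\<bar> * cosh t \<le> \<bar>t\<bar> * 2"
    by (intro mult_mono abs_tanh_le) auto
  then show ?thesis by (simp add: tanh_def)
qed

lemma norm_a_form_le: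
  assumes "\<bar>t\<bar> \<le> psi"
  shows "norm (a_form m t) \<le> 1 / sqrt (real m + 1) * \<bar>t\<bar>"
proof -
  have "norm (a_form m t) = (central m * \<bar>sinh t\<bar> ^ (2 * m)) * \<bar>tanh t\<bar>"
    using central_pos[of m] by (simp add: a_form_def a_coeff_sinh norm_mult norm_power)
  also have "\<dots> \<le> (1 / sqrt (real m + 1) * 1) * \<bar>t\<bar>"
    using central_pos[of m] abs_sinh_le_1[OF assms]
    by (intro mult_mono central_le abs_tanh_le power_le_one) auto
  finally show ?thesis by simp
qed

text \<open>Since \<open>1 \<le> cosh\<close>, the integral of \<open>sinh ^ (2 * m)\<close> is dominated by that of
  \<open>sinh ^ (2 * m) * cosh\<close>; the gain of a factor \<open>1 / (2 * m + 1)\<close> outweighs the growth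
  of \<open>1 / central m\<close>.\<close>

lemma norm_prim_b_form_le:
  assumes "\<bar>t\<bar> \<le> psi"
  shows "norm (prim (b_form m) t) \<le> 4 / sqrt (real m + 1) * \<bar>t\<bar>"
proof -
  \<comment> \<open>This is the primitive of \<open>sinh ^ (2 * m) * cosh / central m\<close> that
    vanishes at \<open>0\<close>. It is odd and increasing, so one comparison serves both signs of
    \<open>t\<close>.\<close>
  let ?\<phi> = "\<lambda>t. 1 / (central m * (2 * real m + 1)) * sinh t ^ (2 * m + 1)"
  have bound: "norm (prim (b_form m) v - prim (b_form m) u) \<le> ?\<phi> v - ?\<phi> u" if "u < v" for u v
  proof (rule differentiable_bound_general[OF that])
    show "continuous_on {u..v} (prim (b_form m))"
      by (rule continuous_on_subset[OF continuous_on_prim[OF b_form_continuous]]) simp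
    show "continuous_on {u..v} ?\<phi>" by (intro continuous_intros)
    fix t
    show "(prim (b_form m) has_vector_derivative b_form m t) (at t)"
      by (rule prim_has_vector_derivative[OF b_form_continuous])
    have "(?\<phi> has_real_derivative
        1 / (central m * (2 * real m + 1)) * (real (2 * m + 1) * sinh t ^ (2 * m) * cosh t)) (at t)"
      by (rule derivative_eq_intros refl | simp)+
    also have "1 / (central m * (2 * real m + 1)) * (real (2 * m + 1) * sinh t ^ (2 * m) * cosh t)
        = sinh t ^ (2 * m) * cosh t / central m"
      by (simp add: divide_simps)
    finally show "(?\<phi> has_vector_derivative sinh t ^ (2 * m) * cosh t / central m) (at t)"
      by (simp add: has_real_derivative_iff_has_vector_derivative)
    have "norm (b_form m t) = sinh t ^ (2 * m) * 1 / central m"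
      using central_pos[of m]
      by (simp add: b_form_def b_coeff_sinh norm_mult norm_power norm_divide power_mult)
    also have "\<dots> \<le> sinh t ^ (2 * m) * cosh t / central m"
      using central_pos[of m] cosh_real_ge_1[of t]
      by (intro divide_right_mono mult_left_mono) (auto simp: power_mult)
    finally show "norm (b_form m t) \<le> sinh t ^ (2 * m) * cosh t / central m" .
  qed
  have "norm (prim (b_form m) t) \<le> \<bar>?\<phi> t\<bar>"
  proof (cases t "0 :: real" rule: linorder_cases)
    case less
    have "norm (prim (b_form m) t) \<le> - ?\<phi> t" using bound[OF less] by simp
    then show ?thesis by (rule order_trans[OF _ abs_ge_minus_self])
  next
    case greater
    have "norm (prim (b_form m) t) \<le> ?\<phi> t" using bound[OF greater] by simp
    then show ?thesis by (rule order_trans[OF _ abs_ge_self])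
  qed simp
  also have "\<dots> = 1 / (central m * (2 * real m + 1)) * \<bar>sinh t\<bar> ^ (2 * m) * \<bar>sinh t\<bar>"
    using central_pos[of m] by (simp add: abs_mult power_abs)
  also have "\<dots> \<le> 2 / sqrt (real m + 1) * 1 * (2 * \<bar>t\<bar>)"
    using abs_sinh_le_1[OF assms]
    by (intro mult_mono inverse_central_le abs_sinh_le assms power_le_one) auto
  finally show ?thesis by simp
qed

section \<open>Operators of whole index lists and their decay\<close>

lemma expr_prod_p_tilde:
  "admissible (expr_prod (map p_tilde s)) \<and>
    (h \<in> cont0 \<longrightarrow> expr_apply (expr_prod (map p_tilde s)) h = foldr (\<lambda>k. expr_apply (p_tilde k)) s h)"
proof (induction s)
  case Nil
  have "admissible expr_one" by (auto simp: admissible_def expr_one_def func_def)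
  then show ?case by (auto simp: expr_prod_def expr_apply_def expr_one_def func_def)
next
  case (Cons k s)
  have "expr_prod (map p_tilde (k # s)) = p_tilde k \<odot> expr_prod (map p_tilde s)"
    by (simp add: expr_prod_def)
  with Cons show ?case
    by (auto simp: expr_apply_comp admissible_p_tilde intro: admissible_comp)
qed

interpretation alpha: telescoping_operators cont0 "\<lambda>k. expr_apply (p_tilde k)" a_form
  by unfold_locales
    (simp_all add: expr_apply_cont0 expr_apply_combine admissible_p_tilde a_form_cont0 a_form_step del: of_nat_Suc One_nat_def)

lemma alpha_bound:
  assumes "\<bar>y\<bar> \<le> psi"
  shows "\<exists>C. \<forall>N. norm (foldr (\<lambda>k. expr_apply (p_tilde k)) s (a_form N) y) \<le> C * (1 / sqrt (real N + 1))"
proof -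
  have E: "admissible (expr_prod (map p_tilde s))"
    and eq: "foldr (\<lambda>k. expr_apply (p_tilde k)) s (a_form N) = expr_apply (expr_prod (map p_tilde s)) (a_form N)" for N
    using expr_prod_p_tilde a_form_cont0 by auto
  obtain C where C: "\<And>h M t. h \<in> cont0 \<Longrightarrow> 0 \<le> M \<Longrightarrow> (\<forall>t. \<bar>t\<bar> \<le> psi \<longrightarrow> norm (h t) \<le> M * \<bar>t\<bar>) \<Longrightarrow>
      \<bar>t\<bar> \<le> psi \<Longrightarrow> norm (expr_apply (expr_prod (map p_tilde s)) h t) \<le> C * M * \<bar>t\<bar>"
    using expr_apply_bound[OF E] by blast
  have "norm (foldr (\<lambda>k. expr_apply (p_tilde k)) s (a_form N) y) \<le> C * \<bar>y\<bar> * (1 / sqrt (real N + 1))" for N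
    using C[OF a_form_cont0[of N], of "1 / sqrt (real N + 1)" y] norm_a_form_le[of _ N] assms
    by (simp add: eq ac_simps)
  then show ?thesis by blast
qed

lemma weight_g_weights: "g \<in> set (g_weights k) \<Longrightarrow> weight g"
  by (auto simp: g_weights_def weight_tanh weight_coth weight_1 split: if_splits)

lemma last_g_weights: "g_weights k \<noteq> []" "last (g_weights k) \<in> {tanh_c, \<lambda>t. 1}"
  by (auto simp: g_weights_def)

lemma nest_last: "w \<noteq> [] \<Longrightarrow> nest w h = nest (butlast w) (\<lambda>t. last w t * prim h t)"
  using nest_append[of "butlast w" "[last w]" h] by simp

text \<open>The functions \<open>u\<close> and \<open>v\<close> may be nonzero at \<open>0\<close>.
  A continuous last weight times a primitive already lies in \<open>cont0\<close>, so only the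
  weights further out may have poles.\<close>

lemma nest_continuous:
  assumes "w \<noteq> []" "\<forall>g\<in>set w. weight g" "continuous_on UNIV (last w)"
    "continuous_on UNIV u" "continuous_on UNIV v"
  shows "nest w u \<in> cont0"
    and "nest w (\<lambda>t. a * u t + b * v t) = (\<lambda>t. a * nest w u t + b * nest w v t)"
proof -
  have cont0: "(\<lambda>t. last w t * prim f t) \<in> cont0" if "continuous_on UNIV f" for f
    by (intro mult_cont0 assms prim_cont0 that)
  have w: "\<forall>g\<in>set (butlast w). weight g" using assms(2) by (auto dest: in_set_butlastD)
  show "nest w u \<in> cont0" using nest_cont0[OF w cont0[OF assms(4)]] by (simp add: nest_last[OF assms(1)])
  have "(\<lambda>t. last w t * prim (\<lambda>t. a * u t + b * v t) t)
      = (\<lambda>t. a * (last w t * prim u t) + b * (last w t * prim v t))"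
    by (simp add: prim_combine[OF assms(4,5)] algebra_simps)
  then show "nest w (\<lambda>t. a * u t + b * v t) = (\<lambda>t. a * nest w u t + b * nest w v t)"
    using nest_combine[OF w cont0[OF assms(4)] cont0[OF assms(5)]] by (simp add: nest_last[OF assms(1)])
qed

lemma continuous_last_g_weights: "continuous_on UNIV (last (g_weights k))"
proof -
  have "continuous_on UNIV tanh_c" by (intro continuous_intros) auto
  then show ?thesis using last_g_weights(2)[of k] by auto
qed

lemmas nest_g_weights = nest_continuous[OF last_g_weights(1) _ continuous_last_g_weights]

interpretation sigma: telescoping_operators "{h. continuous_on UNIV h}" "\<lambda>k. nest (g_weights k)" b_form
proof
  fix k and u v :: "real \<Rightarrow> complex" and a b
  assume uv: "u \<in> {h. continuous_on UNIV h}" "v \<in> {h. continuous_on UNIV h}"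
  show "nest (g_weights k) (\<lambda>t. a * u t + b * v t)
      = (\<lambda>t. a * nest (g_weights k) u t + b * nest (g_weights k) v t)"
    using uv by (intro nest_g_weights(2)) (auto simp: weight_g_weights)
next
  fix k and u :: "real \<Rightarrow> complex"
  assume "u \<in> {h. continuous_on UNIV h}"
  then show "nest (g_weights k) u \<in> {h. continuous_on UNIV h}"
    using nest_g_weights(1)[of k u u] by (auto simp: weight_g_weights cont0_def)
next
  fix k m t assume k: "1 \<le> (k :: nat)"
  have "nest (g_weights k) (\<lambda>t. 1 * b_form (Suc m) t + (- 1) * b_form m t)
    = (\<lambda>t. 1 * nest (g_weights k) (b_form (Suc m)) t + (- 1) * nest (g_weights k) (b_form m) t)"
    by (rule nest_g_weights(2)) (auto simp: weight_g_weights b_form_continuous)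
  then show "nest (g_weights k) (b_form (Suc m)) t - nest (g_weights k) (b_form m) t
    = b_form (Suc m) t / (2 * of_nat (Suc m)) ^ k"
    using b_form_step[OF k, of m t] by (simp del: of_nat_Suc)
qed (simp add: b_form_continuous)

text \<open>The rate is carried by \<open>last w * prim (b_form N)\<close>, not by
  \<open>b_form N\<close>. Since \<open>s\<close> is nonempty, this first integration is present,
  and the remaining weights are handled by \<open>nest_bound\<close>.\<close>

lemma sigma_bound:
  assumes "s \<noteq> []" and y: "\<bar>y\<bar> \<le> psi"
  shows "\<exists>C. \<forall>N. norm (foldr (\<lambda>k. nest (g_weights k)) s (b_form N) y) \<le> C * (1 / sqrt (real N + 1))"
proof -
  define w where "w = concat (map g_weights s)"
  have w: "w \<noteq> []" "\<forall>g\<in>set (butlast w). weight g"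
    using assms(1) last_g_weights(1) unfolding w_def by (cases s) (auto dest!: in_set_butlastD weight_g_weights)
  obtain s' k where s: "s = s' @ [k]" using assms(1) by (cases s rule: rev_cases) auto
  have "last w = last (g_weights k)"
    unfolding w_def s using last_g_weights(1)[of k] by simp
  then have last: "last w \<in> {tanh_c, \<lambda>t. 1}" "continuous_on UNIV (last w)"
    using last_g_weights(2)[of k] continuous_last_g_weights[of k] by auto
  have last_le: "norm (last w t) \<le> 1" for t
    using last(1) tanh_real_bounds[of t] by (auto simp: abs_le_iff)
  have cont0: "(\<lambda>t. last w t * prim (b_form N) t) \<in> cont0" for N
    by (intro mult_cont0 prim_cont0 last(2) b_form_continuous)
  have le: "norm (last w t * prim (b_form N) t) \<le> 4 / sqrt (real N + 1) * \<bar>t\<bar>" if "\<bar>t\<bar> \<le> psi" for t N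
    using mult_mono[OF last_le[of t] norm_prim_b_form_le[OF that, of N]] by (simp add: norm_mult)
  obtain C where C: "\<And>h M t. h \<in> cont0 \<Longrightarrow> 0 \<le> M \<Longrightarrow> (\<forall>t. \<bar>t\<bar> \<le> psi \<longrightarrow> norm (h t) \<le> M * \<bar>t\<bar>) \<Longrightarrow>
      \<bar>t\<bar> \<le> psi \<Longrightarrow> norm (nest (butlast w) h t) \<le> C * M * \<bar>t\<bar>"
    using nest_bound[OF w(2)] by blast
  have "norm (foldr (\<lambda>k. nest (g_weights k)) s (b_form N) y) \<le> C * 4 * \<bar>y\<bar> * (1 / sqrt (real N + 1))" for N
  proof -
    have "norm (nest (butlast w) (\<lambda>t. last w t * prim (b_form N) t) y) \<le> C * (4 / sqrt (real N + 1)) * \<bar>y\<bar>"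
      by (rule C[OF cont0 _ _ y]) (use le in auto)
    then show ?thesis by (simp add: nest_last[OF w(1)] flip: nest_concat w_def)
  qed
  then show ?thesis by blast
qed

text \<open>The integrand is continuous on the whole line, so the derivative is two-sided also at
  \<open>y = psi\<close> and \<open>y = - psi\<close>.\<close>

lemma has_vector_derivative_alpha_integral:
  "(alpha_integral s n has_vector_derivative foldr (\<lambda>k. expr_apply (p_tilde k)) s (a_form n) y) (at y)"
proof -
  have E: "admissible (expr_prod (map p_tilde s))"
    and eq: "expr_apply (expr_prod (map p_tilde s)) (a_form n) = foldr (\<lambda>k. expr_apply (p_tilde k)) s (a_form n)"
    using expr_prod_p_tilde[of s "a_form n"] a_form_cont0[of n] by auto
  have "alpha_integral s n u = expr_integral 0 u (expr_prod (map p_tilde s)) (a_form n)" for u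
    by (simp add: alpha_integral_def a_form_def[abs_def])
  then have "alpha_integral s n = prim (foldr (\<lambda>k. expr_apply (p_tilde k)) s (a_form n))"
    by (simp add: fun_eq_iff expr_integral_eq_prim[OF E a_form_cont0] eq)
  moreover have "continuous_on UNIV (foldr (\<lambda>k. expr_apply (p_tilde k)) s (a_form n))"
    using cont0_continuous[OF expr_apply_cont0[OF E a_form_cont0[of n]]] by (simp only: eq)
  ultimately show ?thesis by (simp add: prim_has_vector_derivative)
qed

lemma has_vector_derivative_sigma_integral:
  assumes "\<forall>j\<in>set s. 1 \<le> j"
  shows "(sigma_integral s n has_vector_derivative foldr (\<lambda>k. nest (g_weights k)) s (b_form n) y) (at y)"
proof -
  have "sigma_integral s n = prim (foldr (\<lambda>k. nest (g_weights k)) s (b_form n))"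
    by (simp add: sigma_integral_def g_prod_eq expr_integral_def iterated_integral_eq_prim
        b_form_def[abs_def] fun_eq_iff flip: nest_concat)
  moreover have "continuous_on UNIV (foldr (\<lambda>k. nest (g_weights k)) s (b_form n))"
    using sigma.foldr_V[OF assms] b_form_continuous by auto
  ultimately show ?thesis by (simp add: prim_has_vector_derivative)
qed

section \<open>Passage to the limit and the point \<open>y = 0\<close>\<close>

lemma truncated_tail_cmult: "truncated_tail (\<lambda>m. x * c m) s n N = x * truncated_tail c s n N"
  by (simp add: truncated_tail_def sum_distrib_left)

lemma truncated_tail_cong:
  assumes "s \<noteq> []" "\<And>m. n < m \<Longrightarrow> c m = c' m"
  shows "truncated_tail c s n N = truncated_tail c' s n N"
  unfolding truncated_tail_def
proof (rule sum.cong[OF refl])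
  fix ns assume ns: "ns \<in> index_tuples (length s) n N"
  then have "hd ns \<in> set ns" using assms(1) by (intro hd_in_set) (auto simp: index_tuples_def)
  with ns have "n < hd ns" by (auto simp: index_tuples_def)
  then show "c (hd ns) / (\<Prod>j<length s. (2 * of_nat (ns ! j)) ^ (s ! j))
    = c' (hd ns) / (\<Prod>j<length s. (2 * of_nat (ns ! j)) ^ (s ! j))"
    by (simp add: assms(2))
qed

theorem theorem6p7:
  fixes n :: nat and s :: "nat list" and y :: real
  assumes "s \<noteq> []"
    and "\<forall>j \<in> set s. 1 \<le> j"
    and "y \<in> {- psi..psi}"
  shows "convergent (alpha_trunc s (\<i> * of_real (sinh y)) n)
       \<and> alpha_integral s n differentiable (at y)
       \<and> alpha_tail s (\<i> * of_real (sinh y)) n =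
           (- 1) ^ length s * of_real (coth y) * vector_derivative (alpha_integral s n) (at y)
       \<and> (y = 0 \<longrightarrow>
           ((\<lambda>u. (- 1) ^ length s * of_real (coth u) * vector_derivative (alpha_integral s n) (at u))
              \<longlongrightarrow> alpha_tail s (\<i> * of_real (sinh y)) n) (at y))
       \<and> convergent (sigma_trunc s (\<i> * of_real (sinh y)) n)
       \<and> sigma_integral s n differentiable (at y)
       \<and> sigma_tail s (\<i> * of_real (sinh y)) n =
           (- 1) ^ length s * vector_derivative (sigma_integral s n) (at y)"
proof -
  have y: "\<bar>y\<bar> \<le> psi" using assms(3) by auto
  let ?z = "\<i> * of_real (sinh y)"
  let ?A = "foldr (\<lambda>k. expr_apply (p_tilde k)) s (a_form n)"
  let ?B = "foldr (\<lambda>k. nest (g_weights k)) s (b_form n)"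
  have rate: "0 \<le> 1 / sqrt (real N + 1)" for N by simp
  have A: "vector_derivative (alpha_integral s n) (at u) = ?A u" for u
    by (rule vector_derivative_at[OF has_vector_derivative_alpha_integral])
  \<comment> \<open>For \<open>y \<noteq> 0\<close>, \<open>coth\<close> removes the
    \<open>tanh\<close> contained in \<open>a_form\<close>. At \<open>y = 0\<close> both sides are
    \<open>0\<close>, the left one because \<open>m > n\<close> forces a positive power of
    \<open>sinh 0\<close>.\<close>
  have "a_coeff m ?z = coth_c y * a_form m y" if "n < m" for m
  proof (cases "y = 0")
    case False
    then show ?thesis by (simp add: a_form_def coth_def tanh_def)
  qed (use that in \<open>simp add: a_form_def a_coeff_def\<close>)
  then have "alpha_trunc s ?z n = (\<lambda>N. coth_c y * truncated_tail (\<lambda>m. a_form m y) s n N)"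
    unfolding alpha_trunc_def fun_eq_iff
    by (subst truncated_tail_cong[OF assms(1), where c' = "\<lambda>m. coth_c y * a_form m y"])
      (auto simp: truncated_tail_cmult)
  moreover
  have "(\<lambda>N. truncated_tail (\<lambda>m. a_form m y) s n N) \<longlonglongrightarrow> (- 1) ^ length s * ?A y"
    by (rule alpha.truncated_tail_tendsto[OF alpha_bound[OF y] rate error_rate_tendsto assms(1,2)])
  from tendsto_mult_left[OF this, of "coth_c y"]
  have "(\<lambda>N. coth_c y * truncated_tail (\<lambda>m. a_form m y) s n N) \<longlonglongrightarrow> (- 1) ^ length s * coth_c y * ?A y"
    by (simp only: mult.assoc mult.left_commute[of "coth_c y"])
  ultimately have alpha: "alpha_trunc s ?z n \<longlonglongrightarrow> (- 1) ^ length s * coth_c y * ?A y"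
    by (simp only:)
  then have alpha_tail: "alpha_tail s ?z n = (- 1) ^ length s * coth_c y * ?A y"
    unfolding alpha_tail_def by (rule limI)
  have sigma: "sigma_trunc s ?z n \<longlonglongrightarrow> (- 1) ^ length s * ?B y"
    using sigma.truncated_tail_tendsto[OF sigma_bound[OF _ y] rate error_rate_tendsto assms(1,2), of n]
    unfolding sigma_trunc_def b_form_def by simp
  \<comment> \<open>At \<open>y = 0\<close> the identity uses the default value
    \<open>coth 0 = 0\<close>; the limit shows that it also holds in the sense of removing the
    singularity. The outermost form \<open>tanh\<close> of the first factor cancels
    \<open>coth\<close> away from \<open>0\<close> and leaves a primitive, which tends to
    \<open>0\<close>.\<close>
  have limit: "((\<lambda>u. (- 1) ^ length s * coth_c u * ?A u) \<longlongrightarrow> alpha_tail s ?z n) (at y)" if "y = 0"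
  proof -
    obtain k s' where s: "s = k # s'" using assms(1) by (cases s) auto
    let ?h = "foldr (\<lambda>k. expr_apply (p_tilde k)) s' (a_form n)"
    let ?g = "\<lambda>t. ?h t - csch_c t * prim (\<lambda>u. sech_c u * ?h u) t"
    let ?p = "prim (nest (replicate (k - 1) coth_c) ?g)"
    have h: "?h \<in> cont0" by (rule alpha.foldr_V) (use assms(2) a_form_cont0 in \<open>auto simp: s\<close>)
    have "continuous_on UNIV sech_c" unfolding sech_def by (intro continuous_intros) auto
    then have "(\<lambda>t. csch_c t * prim (\<lambda>u. sech_c u * ?h u) t) \<in> cont0"
      by (intro weight_prim_cont0 weight_csch mult_cont0 h)
    from cont0_combine[OF h this, of 1 "- 1"] have "?g \<in> cont0" by simp
    then have "nest (replicate (k - 1) coth_c) ?g \<in> cont0"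
      by (intro nest_cont0) (auto simp: weight_coth)
    then have "?p \<in> cont0" by (intro prim_cont0 cont0_continuous)
    then have "(?p \<longlongrightarrow> 0) (at 0)"
      by (auto simp: cont0_def continuous_on_eq_continuous_at isCont_def dest: spec[of _ 0])
    then have "((\<lambda>u. (- 1) ^ length s * ?p u) \<longlongrightarrow> 0) (at 0)"
      by (rule tendsto_mult_right_zero)
    moreover have "\<forall>\<^sub>F u in at 0. (- 1) ^ length s * ?p u = (- 1) ^ length s * coth_c u * ?A u"
    proof -
      have "?A = (\<lambda>t. tanh_c t * ?p t)"
        using expr_apply_p_tilde[OF h, of k] by (simp add: s)
      moreover have "coth_c u * (tanh_c u * v) = v" if "u \<noteq> 0" for u v
        using that by (simp add: coth_def tanh_def)
      ultimately show ?thesis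
        by (auto simp: eventually_at_filter mult.assoc)
    qed
    ultimately have "((\<lambda>u. (- 1) ^ length s * coth_c u * ?A u) \<longlongrightarrow> 0) (at 0)"
      by (rule Lim_transform_eventually)
    then show ?thesis unfolding alpha_tail using that by (simp add: coth_def)
  qed
  show ?thesis
  proof (intro conjI impI)
    show "convergent (alpha_trunc s ?z n)" using alpha by (rule convergentI)
    show "alpha_integral s n differentiable (at y)"
      using has_vector_derivative_alpha_integral by (rule differentiableI_vector)
    show "alpha_tail s ?z n = (- 1) ^ length s * of_real (coth y) * vector_derivative (alpha_integral s n) (at y)"
      by (simp only: A alpha_tail)
    show "((\<lambda>u. (- 1) ^ length s * of_real (coth u) * vector_derivative (alpha_integral s n) (at u))
        \<longlongrightarrow> alpha_tail s ?z n) (at y)" if "y = 0"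
      unfolding A by (rule limit[OF that])
    show "convergent (sigma_trunc s ?z n)" using sigma by (rule convergentI)
    show "sigma_integral s n differentiable (at y)"
      using has_vector_derivative_sigma_integral[OF assms(2)] by (rule differentiableI_vector)
    show "sigma_tail s ?z n = (- 1) ^ length s * vector_derivative (sigma_integral s n) (at y)"
      unfolding sigma_tail_def vector_derivative_at[OF has_vector_derivative_sigma_integral[OF assms(2)]]
      using sigma by (rule limI)
  qed
qed

end
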